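(* Let $f:S_n\to\mathbb{C}$ be a multiplicative function satisfying the condition $|f(\sigma)|\leqslant1$ for all $\sigma\in S_n$. Suppose that the multiplicative function $d(\sigma)$ defining the measure is such that $0<d^-\leqslant\hat d(j)\leqslant d^+$ for all $j\geqslant1$, where $d^-,d^+$ are fixed positive constants. Put $$\Delta_n:=\left|M_n^d(f)-\exp\left\{\sum_{j=1}^n\hat d(j)\frac{\hat f(j)-1}{j}\right\}\right|.$$ Then, for $d^-<1$, $$\Delta_n\leqslant c_1\left(\Bigl(\sum_{j=0}^np_j\Bigr)^{-1}\sum_{k=1}^n|\hat f(k)-1|p_{n-k}+\frac{1}{n^{d^-}}\sum_{k=1}^n|\hat f(k)-1|k^{d^--1}+\frac1n\sum_{k=1}^n|\hat f(k)-1|\right),$$ and, for $d^-\geqslant1$, $$\Delta_n\leqslant c_1\left(\Bigl(\sum_{j=0}^np_j\Bigr)^{-1}\sum_{k=1}^n|\hat f(k)-1|p_{n-k}+\frac1n\sum_{k=1}^n|\hat f(k)-1|\Bigl(1+\log\frac nk\Bigr)\right),$$ where $c_1=c_1(d^-,d^+)$ is a positive constant which depends on $d^-$ and $d^+$ only.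
   Context: $S_n$ is the symmetric group on $\{1,\dots,n\}$, and $\alpha_j(\sigma)$ is the number of cycles of length $j$ in $\sigma\in S_n$. A multiplicative function $f:S_n\to\mathbb{C}$ is one determined by complex numbers $\hat f(1),\dots,\hat f(n)$ through $f(\sigma)=\hat f(1)^{\alpha_1(\sigma)}\hat f(2)^{\alpha_2(\sigma)}\cdots\hat f(n)^{\alpha_n(\sigma)}$, with the convention $0^0=1$. Similarly, $d(\sigma)=\prod_{j=1}^n\hat d(j)^{\alpha_j(\sigma)}$ for a sequence of real numbers $\hat d(j)$, $j\geqslant1$; it defines the probability measure on $S_n$ giving $\sigma$ the mass $d(\sigma)/\sum_{\tau\in S_n}d(\tau)$. The weighted mean of $f$ with respect to this measure is $$M_n^d(f)=\frac{\sum_{\sigma\in S_n}f(\sigma)d(\sigma)}{\sum_{\sigma\in S_n}d(\sigma)}.$$ The numbers $p_n$ are given by $$p_n=\frac1{n!}\sum_{\sigma\in S_n}d(\sigma)=[z^n]\exp\left\{\sum_{j=1}^\infty\frac{\hat d(j)}{j}z^j\right\}$$ (so $p_0=1$), where $[z^n]H(z)$ denotes the $n$-th Taylor coefficient of $H$ at $0$.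
   Formalization: The formal theorem also assumes |f̂(j)| ≤ 1 for 1 ≤ j ≤ n. From |f(σ)| ≤ 1 on one S_n alone the claim fails: n=3, d̂≡1, f̂=(0,N,0) gives f≡0 on S_3, but Δ_3 grows exponentially in N while the right-hand side grows linearly. *)

theory Defs
  imports Complex_Main "HOL-Combinatorics.Orbits"
begin

text \<open>
  Elements of the symmetric group on \<open>{1..n}\<close> are the functions \<open>\<sigma> :: nat \<Rightarrow> nat\<close> with
  \<open>\<sigma> permutes {1..n}\<close> (so they fix everything outside \<open>{1..n}\<close>). Their cycles, fixed points
  included, are identified with their underlying sets, the orbits of the points of \<open>{1..n}\<close>.
\<close>

definition cycle_count :: "nat \<Rightarrow> nat \<Rightarrow> (nat \<Rightarrow> nat) \<Rightarrow> nat" where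
  "cycle_count n j \<sigma> = card {C \<in> orbit \<sigma> ` {1..n}. card C = j}"

text \<open>The convention \<open>0 ^ 0 = 1\<close> is the one of \<^const>\<open>power\<close>. A bound
  \<open>norm (mult_fun n fhat \<sigma>) \<le> 1\<close> for all \<open>\<sigma>\<close> in a single symmetric group does not bound \<open>norm (fhat j)\<close> by 1
  (take \<open>n = 3\<close>, \<open>fhat 1 = 0\<close>, \<open>fhat 2\<close> large, \<open>fhat 3 = 0\<close>), whereas the exponential in \<open>Delta\<close> below
  sees every \<open>fhat j\<close>; a bound on the latter therefore has to be assumed separately.\<close>

definition mult_fun :: "nat \<Rightarrow> (nat \<Rightarrow> 'a::comm_semiring_1) \<Rightarrow> (nat \<Rightarrow> nat) \<Rightarrow> 'a" where
  "mult_fun n fhat \<sigma> = (\<Prod>j=1..n. fhat j ^ cycle_count n j \<sigma>)"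

definition weighted_mean ::
  "nat \<Rightarrow> ((nat \<Rightarrow> nat) \<Rightarrow> real) \<Rightarrow> ((nat \<Rightarrow> nat) \<Rightarrow> complex) \<Rightarrow> complex" where
  "weighted_mean n d f =
     (\<Sum>\<sigma> | \<sigma> permutes {1..n}. f \<sigma> * of_real (d \<sigma>)) / of_real (\<Sum>\<sigma> | \<sigma> permutes {1..n}. d \<sigma>)"

text \<open>
  \<open>p_coeff dhat n\<close> is also the \<open>n\<close>-th Taylor coefficient at 0 of \<open>exp (\<Sum>j\<ge>1. dhat j / j * z ^ j)\<close>;
  only the definition as an average over the symmetric group is used here.
\<close>

definition p_coeff :: "(nat \<Rightarrow> real) \<Rightarrow> nat \<Rightarrow> real" where
  "p_coeff dhat n = (\<Sum>\<sigma> | \<sigma> permutes {1..n}. mult_fun n dhat \<sigma>) / fact n"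

definition Delta :: "nat \<Rightarrow> (nat \<Rightarrow> real) \<Rightarrow> (nat \<Rightarrow> complex) \<Rightarrow> real" where
  "Delta n dhat fhat =
     norm (weighted_mean n (mult_fun n dhat) (mult_fun n fhat)
           - exp (\<Sum>j=1..n. of_real (dhat j) * ((fhat j - 1) / of_nat j)))"

end

theory Submission
  imports Defs "HOL-Analysis.Derivative" "HOL-Computational_Algebra.Formal_Power_Series"
begin

text \<open>
  Write \<open>E(a)\<^sub>m = [z^m] exp (\<Sum>j\<ge>1. a\<^sub>j z^j / j)\<close>, computed by \<open>m E(a)\<^sub>m = \<Sum>i<m. a\<^sub>m\<^sub>-\<^sub>i E(a)\<^sub>i\<close>. By the cycle index formula,
  \<open>p\<^sub>m = E(d)\<^sub>m\<close> and the weighted mean is \<open>E(d f)\<^sub>n / p\<^sub>n\<close>. With \<open>L(x) = \<Sum>j\<le>n. d\<^sub>j (f\<^sub>j - 1) x^j / j\<close> the number to be estimated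
  is therefore \<open>E(d f)\<^sub>n - exp(L(1)) p\<^sub>n\<close>, divided by \<open>p\<^sub>n\<close>.

  Both terms are end values of one function of \<open>x \<in> [0,1]\<close>. Let \<open>G\<^sub>m(x)\<close> have the exponents \<open>d\<^sub>j (1 + x^j (f\<^sub>j - 1))\<close>, so that \<open>G\<^sub>m(0) = p\<^sub>m\<close>
  and \<open>G\<^sub>m(1) = E(d f)\<^sub>m\<close>, and put \<open>\<phi>(x) = exp(L(1) - L(x)) G\<^sub>n(x)\<close>. Then \<open>\<phi>(1) - \<phi>(0)\<close> is the difference in question and
  \<open>\<phi>'(x) = exp(L(1) - L(x)) \<Sum>j. d\<^sub>j (f\<^sub>j - 1) x^(j-1) (G\<^sub>n\<^sub>-\<^sub>j(x) - G\<^sub>n(x))\<close>. The exponential has modulus at most 1 because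
  \<open>Re f\<^sub>j \<le> 1\<close>. So everything reduces to showing that the coefficients \<open>G\<^sub>m(x)\<close> vary slowly with \<open>m\<close>
  (\<open>norm_exp_coeff_minus_exp_le\<close>).

  For \<open>j > n/2\<close> the bound \<open>norm (G\<^sub>m(x)) \<le> p\<^sub>m\<close> is enough; it produces the sum of the \<open>p\<^sub>n\<^sub>-\<^sub>k\<close>, since \<open>n p\<^sub>n\<close> is of the order of
  \<open>\<Sum>i\<le>n. p\<^sub>i\<close>. For \<open>j \<le> n/2\<close> put \<open>\<delta> = min 1 d\<^sup>-\<close> and factor the generating function of the \<open>G\<^sub>m(x)\<close> as
  \<open>((1 - x z) / (1 - z))^\<delta> * V(z)\<close>. The first factor has explicitly controlled, decreasing coefficients: this is where
  the regularity comes from. The exponents of \<open>V\<close> are bounded in modulus by \<open>d\<^sub>j - \<delta> + \<delta> x^j \<in> [0, d\<^sup>+]\<close>, so that its coefficients are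
  dominated by those of \<open>w(z) (1 - x z)^(-\<delta>)\<close>, where \<open>w\<close> has the nonnegative exponents \<open>d\<^sub>j - \<delta>\<close>. Here \<open>d\<^sub>j \<ge> \<delta>\<close> enters.
  Comparing partial sums gives \<open>norm (G\<^sub>n\<^sub>-\<^sub>j(x) - G\<^sub>n(x)) \<le> C p\<^sub>n n^(-\<delta>) (1 - x)^(-\<delta>) (1 + j (1 - x))\<close>
  (\<open>norm_interp_coeff_diff_le\<close>). Integrated against \<open>x^(j-1)\<close> this is of order \<open>p\<^sub>n n^(-\<delta>) j^(\<delta>-1)\<close> if \<open>\<delta> < 1\<close>. If \<open>\<delta> = 1\<close>, the singularity at
  \<open>x = 1\<close> has to be cut off at distance \<open>1/n\<close>, and the integral is of order \<open>p\<^sub>n (1 + log (n/j)) / n\<close>.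
\<close>

section \<open>Taylor coefficients of an exponential\<close>

text \<open>The exponent has no constant term, because division by zero yields zero.\<close>

definition exp_coeff :: "(nat \<Rightarrow> 'a) \<Rightarrow> nat \<Rightarrow> 'a::field_char_0" where
  "exp_coeff a n = fps_nth (fps_exp 1 oo Abs_fps (\<lambda>j. a j / of_nat j)) n"

lemma deriv_exp_fps:
  fixes a :: "nat \<Rightarrow> 'a::field_char_0"
  shows "fps_deriv (Abs_fps (exp_coeff a)) = Abs_fps (exp_coeff a) * Abs_fps (\<lambda>j. a (Suc j))"
proof -
  define A where "A = Abs_fps (\<lambda>j. a j / of_nat j)"
  have E: "Abs_fps (exp_coeff a) = fps_exp 1 oo A"
    by (rule fps_ext) (simp add: exp_coeff_def A_def)
  have "fps_deriv A = Abs_fps (\<lambda>j. a (Suc j))"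
    by (rule fps_ext) (simp add: A_def del: of_nat_Suc)
  moreover have "fps_nth A 0 = 0" by (simp add: A_def)
  ultimately show ?thesis by (simp add: E fps_compose_deriv)
qed

lemma exp_coeff_0 [simp]: "exp_coeff a 0 = 1"
  by (simp add: exp_coeff_def)

lemma exp_coeff_rec:
  fixes a :: "nat \<Rightarrow> 'a::field_char_0"
  shows "of_nat n * exp_coeff a n = (\<Sum>i<n. a (n - i) * exp_coeff a i)"
proof (cases n)
  case (Suc m)
  have "of_nat n * exp_coeff a n = fps_nth (fps_deriv (Abs_fps (exp_coeff a))) m"
    by (simp add: Suc)
  also have "\<dots> = (\<Sum>i=0..m. exp_coeff a i * a (Suc (m - i)))"
    by (simp only: deriv_exp_fps fps_mult_nth fps_nth_Abs_fps)
  also have "\<dots> = (\<Sum>i<n. a (n - i) * exp_coeff a i)"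
    by (rule sum.cong) (auto simp: Suc Suc_diff_le mult.commute)
  finally show ?thesis .
qed simp

text \<open>The identities for \<^const>\<open>exp_coeff\<close> below are obtained by checking this recursion; with the bound \<open>N\<close> it
  also applies to exponents that agree only up to \<open>N\<close>.\<close>

lemma exp_coeff_unique:
  fixes a :: "nat \<Rightarrow> 'a::field_char_0"
  assumes "u 0 = 1"
    and "\<And>n. n \<le> N \<Longrightarrow> n > 0 \<Longrightarrow> of_nat n * u n = (\<Sum>i<n. a (n - i) * u i)"
    and "n \<le> N"
  shows "u n = exp_coeff a n"
  using assms(3)
proof (induction n rule: less_induct)
  case (less n)
  show ?case
  proof (cases "n = 0")
    case False
    have "of_nat n * u n = (\<Sum>i<n. a (n - i) * u i)" using assms(2) less.prems False by auto
    also have "\<dots> = (\<Sum>i<n. a (n - i) * exp_coeff a i)"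
      using less by (intro sum.cong) auto
    also have "\<dots> = of_nat n * exp_coeff a n" by (simp add: exp_coeff_rec)
    finally show ?thesis using False by simp
  qed (simp add: assms)
qed

lemma exp_coeff_cong:
  fixes a :: "nat \<Rightarrow> 'a::field_char_0"
  assumes "\<And>j. 1 \<le> j \<Longrightarrow> j \<le> n \<Longrightarrow> a j = b j"
  shows "exp_coeff a n = exp_coeff b n"
proof (rule exp_coeff_unique[where N = n])
  fix m assume "m \<le> n" "m > 0"
  then show "of_nat m * exp_coeff a m = (\<Sum>i<m. b (m - i) * exp_coeff a i)"
    unfolding exp_coeff_rec by (intro sum.cong) (auto simp: assms)
qed auto

lemma exp_coeff_add:
  fixes a b :: "nat \<Rightarrow> 'a::field_char_0"
  shows "exp_coeff (\<lambda>j. a j + b j) n = (\<Sum>i\<le>n. exp_coeff a i * exp_coeff b (n - i))"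
proof -
  define E where "E = Abs_fps (exp_coeff a) * Abs_fps (exp_coeff b)"
  have "fps_nth E n = exp_coeff (\<lambda>j. a j + b j) n"
  proof (rule exp_coeff_unique[where N = n])
    fix m :: nat assume "m > 0"
    then obtain k where k: "m = Suc k" by (cases m) auto
    have "fps_deriv E = E * Abs_fps (\<lambda>j. a (Suc j) + b (Suc j))"
    proof -
      have "Abs_fps (\<lambda>j. a (Suc j) + b (Suc j)) = Abs_fps (\<lambda>j. a (Suc j)) + Abs_fps (\<lambda>j. b (Suc j))"
        by (rule fps_ext) simp
      then show ?thesis by (simp add: E_def deriv_exp_fps algebra_simps)
    qed
    then have "fps_nth (fps_deriv E) k = fps_nth (E * Abs_fps (\<lambda>j. a (Suc j) + b (Suc j))) k"
      by simp
    then have "of_nat m * fps_nth E m = (\<Sum>i=0..k. fps_nth E i * (a (Suc (k - i)) + b (Suc (k - i))))"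
      unfolding k by (simp add: fps_mult_nth del: of_nat_Suc)
    also have "\<dots> = (\<Sum>i<m. (a (m - i) + b (m - i)) * fps_nth E i)"
      by (rule sum.cong) (auto simp: k Suc_diff_le mult.commute)
    finally show "of_nat m * fps_nth E m = (\<Sum>i<m. (a (m - i) + b (m - i)) * fps_nth E i)" .
  qed (auto simp: E_def)
  then show ?thesis by (simp add: E_def fps_mult_nth atMost_atLeast0)
qed

lemma exp_coeff_scale:
  fixes a :: "nat \<Rightarrow> 'a::field_char_0"
  shows "exp_coeff (\<lambda>j. x ^ j * a j) n = x ^ n * exp_coeff a n"
proof (rule sym, rule exp_coeff_unique[where N = n])
  fix m :: nat
  have "of_nat m * (x ^ m * exp_coeff a m) = x ^ m * (\<Sum>i<m. a (m - i) * exp_coeff a i)"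
    by (simp add: exp_coeff_rec[symmetric])
  also have "\<dots> = (\<Sum>i<m. x ^ (m - i) * a (m - i) * (x ^ i * exp_coeff a i))"
    unfolding sum_distrib_left
  proof (rule sum.cong)
    fix i assume "i \<in> {..<m}"
    then have "x ^ m = x ^ (m - i) * x ^ i" by (simp flip: power_add)
    then show "x ^ m * (a (m - i) * exp_coeff a i) = x ^ (m - i) * a (m - i) * (x ^ i * exp_coeff a i)"
      by (simp add: mult_ac)
  qed auto
  finally show "of_nat m * (x ^ m * exp_coeff a m)
     = (\<Sum>i<m. x ^ (m - i) * a (m - i) * (x ^ i * exp_coeff a i))" .
qed auto

lemma exp_coeff_of_real:
  "exp_coeff (\<lambda>j. complex_of_real (a j)) n = of_real (exp_coeff a n)"
proof (rule sym, rule exp_coeff_unique[where N = n])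
  fix m :: nat
  show "of_nat m * complex_of_real (exp_coeff a m)
     = (\<Sum>i<m. complex_of_real (a (m - i)) * of_real (exp_coeff a i))"
    using arg_cong[OF exp_coeff_rec[of m a], of complex_of_real] by simp
qed auto

text \<open>All absolute estimates rest on this domination principle: the recursion expresses a coefficient as a polynomial with
  nonnegative coefficients in the exponents.\<close>

lemma norm_exp_coeff_le:
  fixes a :: "nat \<Rightarrow> 'a::{field_char_0, real_normed_field}" and b :: "nat \<Rightarrow> real"
  assumes "\<And>j. 1 \<le> j \<Longrightarrow> j \<le> n \<Longrightarrow> norm (a j) \<le> b j"
  shows "norm (exp_coeff a n) \<le> exp_coeff b n"
  using assms
proof (induction n rule: less_induct)
  case (less n)
  show ?case
  proof (cases "n = 0")
    case False
    have "real n * norm (exp_coeff a n) = norm (of_nat n * exp_coeff a n)"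
      by (simp add: norm_mult)
    also have "\<dots> \<le> (\<Sum>i<n. norm (a (n - i)) * norm (exp_coeff a i))"
      unfolding exp_coeff_rec by (intro sum_norm_le) (simp add: norm_mult)
    also have "\<dots> \<le> (\<Sum>i<n. b (n - i) * exp_coeff b i)"
    proof (intro sum_mono mult_mono)
      fix i assume i: "i \<in> {..<n}"
      then show *: "norm (a (n - i)) \<le> b (n - i)" using less.prems[of "n - i"] by simp
      show "0 \<le> b (n - i)" by (rule order_trans[OF norm_ge_zero *])
      show "norm (exp_coeff a i) \<le> exp_coeff b i" using less i by auto
    qed simp
    also have "\<dots> = real n * exp_coeff b n" by (simp add: exp_coeff_rec)
    finally show ?thesis using False by simp
  qed simp
qed

lemma exp_coeff_nonneg:
  fixes b :: "nat \<Rightarrow> real"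
  assumes "\<And>j. 1 \<le> j \<Longrightarrow> j \<le> n \<Longrightarrow> 0 \<le> b j"
  shows "0 \<le> exp_coeff b n"
  using norm_exp_coeff_le[of n b b] assms by (auto intro: order_trans[OF norm_ge_zero])

section \<open>The cycle index formula\<close>

text \<open>Composing with the transposition of a new point \<open>x\<close> and a point \<open>b\<close> inserts \<open>x\<close> into the cycle of \<open>b\<close>, immediately before \<open>b\<close>,
  and leaves the other cycles alone. Every permutation moving \<open>x\<close> arises in exactly one way from a permutation of the other points.\<close>

lemma orbit_insert_new:
  assumes q: "q permutes S" and S: "finite S" "x \<notin> S" and b: "b \<in> S"
  shows "orbit (Transposition.transpose x b \<circ> q) x = insert x (orbit q b)"
    and "z \<in> orbit q b \<Longrightarrow> orbit (Transposition.transpose x b \<circ> q) z = insert x (orbit q b)"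
    and "z \<in> S \<Longrightarrow> z \<notin> orbit q b \<Longrightarrow> orbit (Transposition.transpose x b \<circ> q) z = orbit q z"
proof -
  let ?t = "Transposition.transpose x b \<circ> q"
  have qx: "q x = x" using q S by (simp add: permutes_not_in)
  have t: "?t permutes insert x S"
    using q b by (intro permutes_compose permutes_swap_id permutes_subset[OF q]) auto
  have perm: "permutation q" "permutation ?t"
    using q t S by (auto simp: permutation_permutes)
  have tx: "?t x = b" by (simp add: qx)
  have bb: "b \<in> orbit q b" "x \<in> orbit ?t x"
    using perm by (auto intro: permutation_self_in_orbit)
  have orbS: "orbit q z \<subseteq> S" if "z \<in> S" for z
    using q that by (rule permutes_orbit_subset)
  have t_step: "?t u = (if q u = b then x else q u)" if "u \<in> S" for u
    using that S permutes_in_image[OF q, of u] by (auto simp: Transposition.transpose_def)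
  show 1: "orbit ?t x = insert x (orbit q b)"
  proof (intro equalityI subsetI)
    fix u assume "u \<in> orbit ?t x"
    then show "u \<in> insert x (orbit q b)"
    proof induction
      case base show ?case using bb by (simp only: tx) simp
    next
      case (step y)
      show ?case
      proof (cases "y = x")
        case True then show ?thesis using bb by (simp only: tx) simp
      next
        case False
        then have y: "y \<in> orbit q b" using step by simp
        then have "?t y = (if q y = b then x else q y)" using orbS[OF b] by (intro t_step) auto
        then show ?thesis using orbit.step[OF y] by (simp split: if_splits)
      qed
    qed
  next
    fix u assume "u \<in> insert x (orbit q b)"
    moreover have "u \<in> orbit ?t x" if "u \<in> orbit q b"
      using that
    proof induction
      have b': "b \<in> orbit ?t x" using orbit.base[of ?t x] by (simp only: tx)
      have st: "q y \<in> orbit ?t x" if "y \<in> S" "y \<in> orbit ?t x" for y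
        using orbit.step[OF that(2)] t_step[OF that(1)] b' by (auto split: if_splits)
      case base show ?case by (rule st[OF b b'])
      case (step y)
      have "y \<in> S" using step.hyps orbS[OF b] by blast
      then show ?case using step.IH by (rule st)
    qed
    ultimately show "u \<in> orbit ?t x" using bb by auto
  qed
  show "orbit ?t z = insert x (orbit q b)" if "z \<in> orbit q b"
    using orbit_cyclic_eq3[OF cyclic_on_orbit'[OF perm(2)], of z x] 1 that by simp
  assume z: "z \<in> S" "z \<notin> orbit q b"
  have nb: "u \<noteq> b" if "u \<in> orbit q z" for u
    using that z orbit_swap[of z q b] permutation_self_in_orbit[OF perm(1)] by blast
  show "orbit ?t z = orbit q z"
  proof (rule orbit_cong0[symmetric])
    show "z \<in> orbit q z" using permutation_self_in_orbit[OF perm(1)] .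
    show "q \<in> orbit q z \<rightarrow> orbit q z" by (auto intro: orbit.step)
    fix u assume u: "u \<in> orbit q z"
    then have "q u \<noteq> b" "u \<in> S" using nb orbS[OF z(1)] by (auto intro: orbit.step)
    then show "q u = ?t u" using t_step[of u] by simp
  qed
qed

text \<open>Removing the marked point \<open>x\<close> either deletes its cycle, if \<open>x\<close> is fixed, or passes the mark to the successor of \<open>x\<close> in a
  cycle that is shorter by one. The shift \<open>k\<close> remembers how many points of the marked cycle have been removed.\<close>

lemma sum_marked_cycle_insert:
  fixes a :: "nat \<Rightarrow> 'a::field_char_0" and S :: "'b set"
  assumes S: "finite S" "x \<notin> S"
  shows "(\<Sum>\<sigma> | \<sigma> permutes insert x S. a (k + card (orbit \<sigma> x)) *
            (\<Prod>C\<in>orbit \<sigma> ` insert x S - {orbit \<sigma> x}. a (card C)))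
       = a (Suc k) * (\<Sum>\<sigma> | \<sigma> permutes S. \<Prod>C\<in>orbit \<sigma> ` S. a (card C))
         + (\<Sum>b\<in>S. \<Sum>\<sigma> | \<sigma> permutes S. a (Suc k + card (orbit \<sigma> b)) *
              (\<Prod>C\<in>orbit \<sigma> ` S - {orbit \<sigma> b}. a (card C)))"
proof -
  define u where "u = (\<lambda>\<sigma>. a (k + card (orbit \<sigma> x)) *
            (\<Prod>C\<in>orbit \<sigma> ` insert x S - {orbit \<sigma> x}. a (card C)))"
  have fixed: "u (Transposition.transpose x x \<circ> q) = a (Suc k) * (\<Prod>C\<in>orbit q ` S. a (card C))"
    if q: "q permutes S" for q
  proof -
    have "q x = x" using q S by (simp add: permutes_not_in)
    then have ox: "orbit q x = {x}" by (simp add: orbit_eq_singleton_iff)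
    have "x \<notin> orbit q z" if "z \<in> S" for z
      using permutes_orbit_subset[OF q that] S by blast
    then have "orbit q ` insert x S - {orbit q x} = orbit q ` S" by (auto simp: ox)
    then show ?thesis by (simp add: u_def ox)
  qed
  have ins: "u (Transposition.transpose x b \<circ> q)
      = a (Suc k + card (orbit q b)) * (\<Prod>C\<in>orbit q ` S - {orbit q b}. a (card C))"
    if q: "q permutes S" and b: "b \<in> S" for q b
  proof -
    let ?t = "Transposition.transpose x b \<circ> q"
    note orb = orbit_insert_new[OF q S b]
    have perm: "permutation q" using q S by (auto simp: permutation_permutes)
    have sub: "orbit q z \<subseteq> S" if "z \<in> S" for z using permutes_orbit_subset[OF q that] .
    have x: "x \<notin> orbit q z" if "z \<in> S" for z using sub[OF that] S by blast
    have fin: "finite (orbit q b)" using sub[OF b] S finite_subset by blast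
    have in_iff: "z \<in> orbit q b \<longleftrightarrow> orbit q z = orbit q b" for z
    proof
      assume "z \<in> orbit q b"
      then show "orbit q z = orbit q b"
        by (rule orbit_cyclic_eq3[OF cyclic_on_orbit'[OF perm]])
    next
      assume "orbit q z = orbit q b"
      then show "z \<in> orbit q b" using permutation_self_in_orbit[OF perm, of z] by simp
    qed
    have "orbit ?t ` insert x S - {orbit ?t x} = orbit q ` (S - orbit q b)"
    proof -
      have "orbit ?t ` insert x S
          = insert (orbit ?t x) (orbit ?t ` (S \<inter> orbit q b) \<union> orbit ?t ` (S - orbit q b))"
        by blast
      also have "orbit ?t ` (S - orbit q b) = orbit q ` (S - orbit q b)"
        using orb(3) by (intro image_cong) auto
      finally have eq: "orbit ?t ` insert x S
          = insert (orbit ?t x) (orbit ?t ` (S \<inter> orbit q b) \<union> orbit q ` (S - orbit q b))" .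
      have "insert X (A \<union> B) - {X} = B" if "A \<subseteq> {X}" "X \<notin> B" for X and A B :: "'b set set"
        using that by blast
      moreover have "orbit ?t ` (S \<inter> orbit q b) \<subseteq> {orbit ?t x}" using orb(1,2) by auto
      moreover have "orbit ?t x \<notin> orbit q ` (S - orbit q b)" using x orb(1) by auto
      ultimately show ?thesis unfolding eq .
    qed
    also have "\<dots> = orbit q ` S - {orbit q b}" using in_iff by auto
    finally show ?thesis using x[OF b] fin by (simp add: u_def orb(1))
  qed
  have "(\<Sum>\<sigma> | \<sigma> permutes insert x S. u \<sigma>)
      = (\<Sum>b\<in>insert x S. \<Sum>q | q permutes S. u (Transposition.transpose x b \<circ> q))"
    by (rule sum_over_permutations_insert[OF S])
  also have "\<dots> = (\<Sum>q | q permutes S. u (Transposition.transpose x x \<circ> q))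
      + (\<Sum>b\<in>S. \<Sum>q | q permutes S. u (Transposition.transpose x b \<circ> q))"
    using S by (rule sum.insert)
  also have "(\<Sum>q | q permutes S. u (Transposition.transpose x x \<circ> q))
      = a (Suc k) * (\<Sum>q | q permutes S. \<Prod>C\<in>orbit q ` S. a (card C))"
    unfolding sum_distrib_left by (intro sum.cong refl fixed) simp
  also have "(\<Sum>b\<in>S. \<Sum>q | q permutes S. u (Transposition.transpose x b \<circ> q))
      = (\<Sum>b\<in>S. \<Sum>\<sigma> | \<sigma> permutes S. a (Suc k + card (orbit \<sigma> b)) *
              (\<Prod>C\<in>orbit \<sigma> ` S - {orbit \<sigma> b}. a (card C)))"
    by (intro sum.cong refl ins) simp_all
  finally show ?thesis by (simp only: u_def)
qed

text \<open>The two sums determine each other: without a shift, the sum with a marked cycle is the sum over all permutations of one more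
  point, and by the preceding lemma the marked sums are built up from smaller unmarked ones. Unrolling this yields the recursion
  of \<^const>\<open>exp_coeff\<close>.\<close>

lemma sum_marked_cycle_and_sum_cycles:
  fixes a :: "nat \<Rightarrow> 'a::field_char_0" and S :: "'b set"
  assumes "finite S" "card S = n"
  shows "(\<Sum>\<sigma> | \<sigma> permutes S. \<Prod>C\<in>orbit \<sigma> ` S. a (card C)) = fact n * exp_coeff a n"
    and "x \<notin> S \<Longrightarrow> (\<Sum>\<sigma> | \<sigma> permutes insert x S. a (k + card (orbit \<sigma> x)) *
            (\<Prod>C\<in>orbit \<sigma> ` insert x S - {orbit \<sigma> x}. a (card C)))
          = fact n * (\<Sum>i\<le>n. a (k + Suc n - i) * exp_coeff a i)"
proof -
  have "(\<Sum>\<sigma> | \<sigma> permutes S. \<Prod>C\<in>orbit \<sigma> ` S. a (card C)) = fact n * exp_coeff a n \<and>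
    (\<forall>x k. x \<notin> S \<longrightarrow> (\<Sum>\<sigma> | \<sigma> permutes insert x S. a (k + card (orbit \<sigma> x)) *
            (\<Prod>C\<in>orbit \<sigma> ` insert x S - {orbit \<sigma> x}. a (card C)))
          = fact n * (\<Sum>i\<le>n. a (k + Suc n - i) * exp_coeff a i))"
    using assms
  proof (induction n arbitrary: S)
    case 0
    then have "S = {}" by simp
    moreover have "orbit (\<lambda>y. y) x = {x}" for x :: 'b by (simp add: orbit_eq_singleton_iff)
    ultimately show ?case by (simp add: sum_marked_cycle_insert[of "{}", simplified] id_def)
  next
    case (Suc n)
    have marked: "(\<Sum>\<sigma> | \<sigma> permutes S. a (k + card (orbit \<sigma> b)) *
              (\<Prod>C\<in>orbit \<sigma> ` S - {orbit \<sigma> b}. a (card C)))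
         = fact n * (\<Sum>i\<le>n. a (k + Suc n - i) * exp_coeff a i)" if b: "b \<in> S" for b k
    proof -
      obtain R where R: "S = insert b R" "b \<notin> R" using b by (rule Set.set_insert)
      then have "finite R" "card R = n" using Suc.prems by auto
      then show ?thesis unfolding R(1) using Suc.IH[of R] R(2) by blast
    qed
    have total: "(\<Sum>\<sigma> | \<sigma> permutes S. \<Prod>C\<in>orbit \<sigma> ` S. a (card C)) = fact (Suc n) * exp_coeff a (Suc n)"
    proof -
      from Suc.prems obtain b where b: "b \<in> S" by (metis card.empty equals0I nat.distinct(1))
      have "(\<Sum>\<sigma> | \<sigma> permutes S. \<Prod>C\<in>orbit \<sigma> ` S. a (card C))
         = (\<Sum>\<sigma> | \<sigma> permutes S. a (0 + card (orbit \<sigma> b)) *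
              (\<Prod>C\<in>orbit \<sigma> ` S - {orbit \<sigma> b}. a (card C)))"
      proof (intro sum.cong refl)
        fix \<sigma>
        have "finite (orbit \<sigma> ` S)" "orbit \<sigma> b \<in> orbit \<sigma> ` S" using Suc.prems b by auto
        then show "(\<Prod>C\<in>orbit \<sigma> ` S. a (card C)) = a (0 + card (orbit \<sigma> b)) *
              (\<Prod>C\<in>orbit \<sigma> ` S - {orbit \<sigma> b}. a (card C))"
          by (simp only: prod.remove add_0)
      qed
      also have "\<dots> = fact n * (\<Sum>i<Suc n. a (Suc n - i) * exp_coeff a i)"
        by (subst marked[OF b]) (simp only: lessThan_Suc_atMost add_0)
      also have "\<dots> = fact (Suc n) * exp_coeff a (Suc n)"
        by (simp add: exp_coeff_rec[symmetric] del: of_nat_Suc sum.lessThan_Suc)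
      finally show ?thesis .
    qed
    have "(\<Sum>\<sigma> | \<sigma> permutes insert x S. a (k + card (orbit \<sigma> x)) *
            (\<Prod>C\<in>orbit \<sigma> ` insert x S - {orbit \<sigma> x}. a (card C)))
          = fact (Suc n) * (\<Sum>i\<le>Suc n. a (k + Suc (Suc n) - i) * exp_coeff a i)"
      if x: "x \<notin> S" for x k
    proof -
      have "(\<Sum>\<sigma> | \<sigma> permutes insert x S. a (k + card (orbit \<sigma> x)) *
            (\<Prod>C\<in>orbit \<sigma> ` insert x S - {orbit \<sigma> x}. a (card C)))
         = a (Suc k) * (fact (Suc n) * exp_coeff a (Suc n))
           + (\<Sum>b\<in>S. fact n * (\<Sum>i\<le>n. a (Suc k + Suc n - i) * exp_coeff a i))"
        by (simp only: sum_marked_cycle_insert[OF Suc.prems(1) x] total marked cong: sum.cong)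
      also have "\<dots> = fact (Suc n) * (\<Sum>i\<le>Suc n. a (k + Suc (Suc n) - i) * exp_coeff a i)"
        using Suc.prems(2) by (simp add: algebra_simps)
      finally show ?thesis .
    qed
    then show ?case using total by blast
  qed
  then show "(\<Sum>\<sigma> | \<sigma> permutes S. \<Prod>C\<in>orbit \<sigma> ` S. a (card C)) = fact n * exp_coeff a n"
    and "x \<notin> S \<Longrightarrow> (\<Sum>\<sigma> | \<sigma> permutes insert x S. a (k + card (orbit \<sigma> x)) *
            (\<Prod>C\<in>orbit \<sigma> ` insert x S - {orbit \<sigma> x}. a (card C)))
          = fact n * (\<Sum>i\<le>n. a (k + Suc n - i) * exp_coeff a i)" by blast+
qed

lemma mult_fun_eq_prod_orbits:
  assumes "\<sigma> permutes {1..n}"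
  shows "mult_fun n a \<sigma> = (\<Prod>C\<in>orbit \<sigma> ` {1..n}. a (card C))"
proof -
  let ?O = "orbit \<sigma> ` {1..n}"
  have perm: "permutation \<sigma>" using assms by (auto simp: permutation_permutes)
  have "card C \<in> {1..n}" if "C \<in> ?O" for C
  proof -
    obtain z where z: "z \<in> {1..n}" "C = orbit \<sigma> z" using \<open>C \<in> ?O\<close> by blast
    have sub: "C \<subseteq> {1..n}" using permutes_orbit_subset[OF assms z(1)] z by simp
    moreover have "z \<in> C" using z perm by (auto intro: permutation_self_in_orbit)
    ultimately have "card C > 0" by (metis card_gt_0_iff empty_iff finite_atLeastAtMost finite_subset)
    moreover have "card C \<le> n" using card_mono[OF _ sub] by simp
    ultimately show ?thesis by simp
  qed
  then have "(\<Prod>C\<in>?O. a (card C)) = (\<Prod>j=1..n. \<Prod>C | C \<in> ?O \<and> card C = j. a (card C))"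
    by (intro prod.group[symmetric]) auto
  also have "\<dots> = mult_fun n a \<sigma>"
    unfolding mult_fun_def cycle_count_def by (intro prod.cong) auto
  finally show ?thesis by simp
qed

lemma sum_mult_fun:
  fixes a :: "nat \<Rightarrow> 'a::field_char_0"
  shows "(\<Sum>\<sigma> | \<sigma> permutes {1..n}. mult_fun n a \<sigma>) = fact n * exp_coeff a n"
proof -
  have "(\<Sum>\<sigma> | \<sigma> permutes {1..n}. mult_fun n a \<sigma>)
      = (\<Sum>\<sigma> | \<sigma> permutes {1..n}. \<Prod>C\<in>orbit \<sigma> ` {1..n}. a (card C))"
    by (intro sum.cong refl mult_fun_eq_prod_orbits) simp
  also have "\<dots> = fact n * exp_coeff a n"
    by (rule sum_marked_cycle_and_sum_cycles(1)) simp_all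
  finally show ?thesis .
qed

lemma p_coeff_eq_exp_coeff: "p_coeff d n = exp_coeff d n"
  unfolding p_coeff_def sum_mult_fun by simp

lemma weighted_mean_mult_fun:
  "weighted_mean n (mult_fun n d) (mult_fun n f)
     = exp_coeff (\<lambda>j. of_real (d j) * f j) n / of_real (exp_coeff d n)"
proof -
  have "mult_fun n f \<sigma> * of_real (mult_fun n d \<sigma>) = mult_fun n (\<lambda>j. of_real (d j) * f j) \<sigma>" for \<sigma>
    by (simp add: mult_fun_def power_mult_distrib prod.distrib mult.commute)
  then show ?thesis by (simp only: weighted_mean_def sum_mult_fun) simp
qed

section \<open>Growth of coefficients with nonnegative exponents\<close>

lemma exp_coeff_le_sum:
  fixes a :: "nat \<Rightarrow> real"
  assumes "\<And>j. 1 \<le> j \<Longrightarrow> j \<le> n \<Longrightarrow> 0 \<le> a j \<and> a j \<le> D"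
  shows "real n * exp_coeff a n \<le> D * (\<Sum>i<n. exp_coeff a i)"
  unfolding exp_coeff_rec sum_distrib_left
  by (intro sum_mono mult_right_mono exp_coeff_nonneg) (use assms in auto)

lemma sum_le_exp_coeff:
  fixes a :: "nat \<Rightarrow> real"
  assumes "\<And>j. 1 \<le> j \<Longrightarrow> j \<le> n \<Longrightarrow> \<delta> \<le> a j" "0 \<le> \<delta>"
  shows "\<delta> * (\<Sum>i<n. exp_coeff a i) \<le> real n * exp_coeff a n"
  unfolding exp_coeff_rec sum_distrib_left
  by (intro sum_mono mult_right_mono exp_coeff_nonneg) (use assms in \<open>auto intro: order_trans\<close>)

lemma sum_exp_coeff_le_last:
  fixes a :: "nat \<Rightarrow> real"
  assumes "\<And>j. 1 \<le> j \<Longrightarrow> j \<le> n \<Longrightarrow> \<delta> \<le> a j" "0 < \<delta>" "n \<ge> 1"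
  shows "(\<Sum>i\<le>n. exp_coeff a i) \<le> (1 + 1 / \<delta>) * (real n * exp_coeff a n)"
proof -
  have "\<delta> * (\<Sum>i<n. exp_coeff a i) \<le> real n * exp_coeff a n"
    using assms by (intro sum_le_exp_coeff) auto
  then have "(\<Sum>i<n. exp_coeff a i) \<le> (real n * exp_coeff a n) / \<delta>"
    using assms by (simp add: field_simps)
  moreover have "exp_coeff a n \<le> real n * exp_coeff a n"
  proof -
    have "0 \<le> exp_coeff a n"
      using assms by (intro exp_coeff_nonneg) (auto intro: order_trans[of 0 \<delta>])
    then have "1 * exp_coeff a n \<le> real n * exp_coeff a n"
      using \<open>n \<ge> 1\<close> by (intro mult_right_mono) auto
    then show ?thesis by simp
  qed
  ultimately show ?thesis by (simp add: lessThan_Suc_atMost[symmetric] algebra_simps)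
qed

lemma sum_exp_coeff_double:
  fixes a :: "nat \<Rightarrow> real"
  assumes a: "\<And>j. 1 \<le> j \<Longrightarrow> 0 \<le> a j \<and> a j \<le> D" and "n \<ge> 1"
  shows "(\<Sum>i\<le>2 * n. exp_coeff a i) \<le> exp D * (\<Sum>i\<le>n. exp_coeff a i)"
proof -
  have D: "0 \<le> D" using a[of 1] by simp
  have nn: "0 \<le> exp_coeff a i" for i using a by (intro exp_coeff_nonneg) auto
  have "(\<Sum>i\<le>n + m. exp_coeff a i) \<le> exp (m * (D / n)) * (\<Sum>i\<le>n. exp_coeff a i)" for m
  proof (induction m)
    case (Suc m)
    let ?S = "\<Sum>i\<le>n + m. exp_coeff a i"
    have S: "0 \<le> ?S" by (intro sum_nonneg nn)
    have "real n * exp_coeff a (Suc (n + m)) \<le> real (Suc (n + m)) * exp_coeff a (Suc (n + m))"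
      by (intro mult_right_mono nn) auto
    also have "\<dots> \<le> D * ?S"
      using exp_coeff_le_sum[of "Suc (n + m)" a D] a by (simp add: lessThan_Suc_atMost del: of_nat_Suc)
    finally have "exp_coeff a (Suc (n + m)) \<le> (D / n) * ?S"
      using \<open>n \<ge> 1\<close> by (simp add: field_simps)
    then have "(\<Sum>i\<le>n + Suc m. exp_coeff a i) \<le> (1 + D / n) * ?S"
      by (simp add: algebra_simps)
    also have "\<dots> \<le> exp (D / n) * (exp (m * (D / n)) * (\<Sum>i\<le>n. exp_coeff a i))"
      using Suc S by (intro mult_mono) auto
    also have "\<dots> = exp (Suc m * (D / n)) * (\<Sum>i\<le>n. exp_coeff a i)"
      by (simp add: exp_add[symmetric] algebra_simps add_divide_distrib)
    finally show ?case .
  qed simp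
  from this[of n] show ?thesis using \<open>n \<ge> 1\<close> by (simp add: mult_2)
qed

lemma one_plus_powr_le:
  fixes t :: real
  assumes "0 \<le> t" "0 \<le> \<delta>" "\<delta> \<le> 1"
  shows "(1 + t) powr \<delta> \<le> 1 + \<delta> * t"
  using Youngs_inequality_0[of \<delta> "1 - \<delta>" "1 + t" 1] assms by (simp add: algebra_simps)

text \<open>For constant exponents the generating function is \<open>(1 - z)^(-\<delta>)\<close>, and its partial sums are \<open>\<Prod>k=1..n. 1 + \<delta> / k\<close>. Each factor
  is at least \<open>(1 + 1 / k)^\<delta>\<close>, and these telescope.\<close>

lemma sum_exp_coeff_const_ge:
  assumes "0 \<le> \<delta>" "\<delta> \<le> 1"
  shows "(real n + 1) powr \<delta> \<le> (\<Sum>k\<le>n. exp_coeff (\<lambda>_. \<delta>) k)"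
proof (induction n)
  case (Suc n)
  let ?B = "\<Sum>k\<le>n. exp_coeff (\<lambda>_. \<delta>) k"
  have "(real (Suc n) + 1) powr \<delta> = ((1 + 1 / (real n + 1)) * (real n + 1)) powr \<delta>"
  proof -
    have "real (Suc n) + 1 = (1 + 1 / (real n + 1)) * (real n + 1)"
      by (simp add: distrib_right)
    then show ?thesis by simp
  qed
  also have "\<dots> = (1 + 1 / (real n + 1)) powr \<delta> * (real n + 1) powr \<delta>"
    by (rule powr_mult)
  also have "\<dots> \<le> (1 + \<delta> * (1 / (real n + 1))) * ?B"
    using Suc assms by (intro mult_mono one_plus_powr_le) auto
  also have "\<dots> = ?B + \<delta> * ?B / real (Suc n)" by (simp add: algebra_simps)
  also have "\<delta> * ?B / real (Suc n) = exp_coeff (\<lambda>_. \<delta>) (Suc n)"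
    using exp_coeff_rec[of "Suc n" "\<lambda>_. \<delta>"]
    by (simp add: lessThan_Suc_atMost sum_distrib_left field_simps del: sum.lessThan_Suc)
  finally show ?case by simp
qed simp

text \<open>A partial sum \<open>B\<close> of the binomial series satisfies \<open>(1 - t) B'(t) \<le> \<delta> B(t)\<close>, with equality for the full series, so that
  \<open>(1 - t)^\<delta> B(t)\<close> decreases from its value \<open>1\<close> at \<open>0\<close>.\<close>

lemma sum_exp_coeff_const_power_le:
  fixes x :: real
  assumes "0 \<le> \<delta>" "0 \<le> x" "x < 1"
  shows "(\<Sum>k\<le>n. exp_coeff (\<lambda>_. \<delta>) k * x ^ k) \<le> (1 - x) powr (- \<delta>)"
proof -
  let ?b = "exp_coeff (\<lambda>_. \<delta>)"
  have nn: "0 \<le> ?b k" for k using assms by (intro exp_coeff_nonneg) auto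
  define B where "B = (\<lambda>t::real. \<Sum>k\<le>n. ?b k * t ^ k)"
  define B' where "B' = (\<lambda>t::real. \<Sum>k\<le>n. ?b k * (real k * t ^ (k - 1)))"
  have B'_le: "B' t * (1 - t) \<le> \<delta> * B t" if "0 \<le> t" for t
  proof -
    have eq: "\<delta> * ?b k = real (Suc k) * ?b (Suc k) - real k * ?b k" for k
      using exp_coeff_rec[of "Suc k" "\<lambda>_. \<delta>"] exp_coeff_rec[of k "\<lambda>_. \<delta>"] by simp
    have "\<delta> * B t = (\<Sum>k\<le>n. real (Suc k) * ?b (Suc k) * t ^ k) - (\<Sum>k\<le>n. real k * ?b k * t ^ k)"
      by (simp only: B_def sum_distrib_left mult.assoc[symmetric] eq left_diff_distrib sum_subtractf)
    also have "(\<Sum>k\<le>n. real k * ?b k * t ^ k) = t * B' t"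
      unfolding B'_def sum_distrib_left
    proof (rule sum.cong)
      fix k show "real k * ?b k * t ^ k = t * (?b k * (real k * t ^ (k - 1)))"
        by (cases k) auto
    qed auto
    also have "(\<Sum>k\<le>n. real (Suc k) * ?b (Suc k) * t ^ k) = B' t + real (Suc n) * ?b (Suc n) * t ^ n"
    proof -
      have "B' t + real (Suc n) * ?b (Suc n) * t ^ n = (\<Sum>k\<le>Suc n. ?b k * (real k * t ^ (k - 1)))"
        by (simp add: B'_def mult_ac)
      also have "\<dots> = (\<Sum>k\<le>n. real (Suc k) * ?b (Suc k) * t ^ k)"
        by (subst sum.atMost_Suc_shift) (simp add: mult_ac)
      finally show ?thesis ..
    qed
    finally show ?thesis using that nn[of "Suc n"] by (simp add: algebra_simps)
  qed
  have "B x * (1 - x) powr \<delta> \<le> B 0 * (1 - 0) powr \<delta>"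
  proof (rule DERIV_nonpos_imp_nonincreasing[OF assms(2)])
    fix t assume t: "0 \<le> t" "t \<le> x"
    have B: "(B has_real_derivative B' t) (at t)"
      unfolding B_def B'_def by (auto intro!: derivative_eq_intros sum.cong)
    have "((\<lambda>t. B t * (1 - t) powr \<delta>) has_real_derivative
        B' t * (1 - t) powr \<delta> - B t * (\<delta> * (1 - t) powr (\<delta> - 1))) (at t)"
      using t assms by (auto intro!: derivative_eq_intros B)
    moreover have "B' t * (1 - t) powr \<delta> - B t * (\<delta> * (1 - t) powr (\<delta> - 1))
        = (B' t * (1 - t) - \<delta> * B t) * (1 - t) powr (\<delta> - 1)"
      using t assms by (simp add: powr_diff field_simps)
    moreover have "(B' t * (1 - t) - \<delta> * B t) * (1 - t) powr (\<delta> - 1) \<le> 0"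
      using B'_le[OF t(1)] by (intro mult_nonpos_nonneg) auto
    ultimately show "\<exists>y. ((\<lambda>t. B t * (1 - t) powr \<delta>) has_real_derivative y) (at t) \<and> y \<le> 0"
      by metis
  qed
  also have "B 0 = 1" by (simp add: B_def power_0_left if_distrib cong: if_cong)
  finally show ?thesis using assms by (simp add: B_def powr_minus field_simps)
qed

section \<open>The regular factor\<close>

text \<open>These are the Taylor coefficients of \<open>((1 - x z) / (1 - z))^\<delta>\<close>.\<close>

definition ratio_coeff :: "real \<Rightarrow> real \<Rightarrow> nat \<Rightarrow> real" where
  "ratio_coeff \<delta> x = exp_coeff (\<lambda>j. \<delta> * (1 - x ^ j))"

context
  fixes \<delta> x :: real
  assumes \<delta>: "0 \<le> \<delta>" "\<delta> \<le> 1" and x: "0 \<le> x" "x \<le> 1"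
begin

lemma ratio_coeff_0: "ratio_coeff \<delta> x 0 = 1"
  by (simp add: ratio_coeff_def)

lemma ratio_coeff_nonneg: "0 \<le> ratio_coeff \<delta> x k"
  unfolding ratio_coeff_def using \<delta> x by (intro exp_coeff_nonneg mult_nonneg_nonneg) (auto simp: power_le_one)

text \<open>The recursion of \<^const>\<open>exp_coeff\<close> involves all earlier coefficients; eliminating its partial sums \<open>C\<close> and \<open>s\<close> leaves a
  three-term recursion. In this form it is a recursion for the differences in which every term is visibly nonnegative.\<close>

lemma ratio_coeff_rec:
  "real (k + 2) * (ratio_coeff \<delta> x (Suc k) - ratio_coeff \<delta> x (k + 2))
    = x * real k * (ratio_coeff \<delta> x k - ratio_coeff \<delta> x (Suc k)) + (1 - \<delta>) * (1 - x) * ratio_coeff \<delta> x (Suc k)"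
proof -
  define C where "C k = (\<Sum>i<Suc k. ratio_coeff \<delta> x i)" for k
  define s where "s k = (\<Sum>i<Suc k. x ^ (k - i) * ratio_coeff \<delta> x i)" for k
  have x_s: "x * s k = (\<Sum>i<Suc k. x ^ (Suc k - i) * ratio_coeff \<delta> x i)" for k
    unfolding s_def sum_distrib_left by (intro sum.cong) (auto simp: Suc_diff_le)
  have s_Suc: "s (Suc k) = ratio_coeff \<delta> x (Suc k) + x * s k" for k
    unfolding x_s s_def[of "Suc k"] by (subst sum.lessThan_Suc) simp
  have 1: "real (Suc k) * ratio_coeff \<delta> x (Suc k) = \<delta> * (C k - x * s k)" for k
    using exp_coeff_rec[of "Suc k" "\<lambda>j. \<delta> * (1 - x ^ j)"] x_s[of k]
    by (simp add: C_def ratio_coeff_def sum_subtractf[symmetric] sum_distrib_left algebra_simps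
         del: sum.lessThan_Suc of_nat_Suc)
  have C_Suc: "C (Suc k) = C k + ratio_coeff \<delta> x (Suc k)" by (simp add: C_def)
  have "real (k + 2) * ratio_coeff \<delta> x (k + 2) = \<delta> * (C k + ratio_coeff \<delta> x (Suc k) - x * (ratio_coeff \<delta> x (Suc k) + x * s k))"
    using 1[of "Suc k"] by (simp add: C_Suc s_Suc)
  moreover have "real k * ratio_coeff \<delta> x k = \<delta> * (C k - s k)"
  proof (cases k)
    case 0 then show ?thesis by (simp add: C_def s_def)
  next
    case (Suc m)
    show ?thesis using 1[of m] C_def s_Suc[of m] unfolding Suc by (simp add: C_def)
  qed
  ultimately show ?thesis using 1[of k] by (simp add: algebra_simps) algebra
qed

text \<open>The bound on the coefficient and the two on the difference are proved simultaneously because each step needs all of them.\<close>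

lemma ratio_coeff_bounds:
  "ratio_coeff \<delta> x (Suc k) \<le> 1 - x \<and> 0 \<le> ratio_coeff \<delta> x (Suc k) - ratio_coeff \<delta> x (Suc (Suc k)) \<and>
   ratio_coeff \<delta> x (Suc k) - ratio_coeff \<delta> x (Suc (Suc k)) \<le> (1 - x) / real (Suc (Suc k))"
proof (induction k)
  case 0
  have "ratio_coeff \<delta> x (Suc 0) = \<delta> * (1 - x)" using exp_coeff_rec[of "Suc 0" "\<lambda>j. \<delta> * (1 - x ^ j)"]
    by (simp add: ratio_coeff_def)
  then have 1: "ratio_coeff \<delta> x (Suc 0) \<le> 1 - x" using \<delta> x by (simp add: mult_left_le_one_le)
  have "2 * (ratio_coeff \<delta> x (Suc 0) - ratio_coeff \<delta> x (Suc (Suc 0))) = (1 - \<delta>) * (1 - x) * ratio_coeff \<delta> x (Suc 0)"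
    using ratio_coeff_rec[of 0] by simp
  moreover have "0 \<le> (1 - \<delta>) * (1 - x) * ratio_coeff \<delta> x (Suc 0)"
    using ratio_coeff_nonneg \<delta> x by simp
  moreover have "(1 - \<delta>) * (1 - x) * ratio_coeff \<delta> x (Suc 0) \<le> 1 * 1 * (1 - x)"
    using 1 ratio_coeff_nonneg \<delta> x by (intro mult_mono) auto
  ultimately show ?case using 1 by simp
next
  case (Suc k)
  let ?e = "ratio_coeff \<delta> x (Suc k) - ratio_coeff \<delta> x (Suc (Suc k))" and ?c = "ratio_coeff \<delta> x (Suc (Suc k))"
  have rec: "real (k + 3) * (?c - ratio_coeff \<delta> x (Suc (Suc (Suc k)))) = x * real (Suc k) * ?e + (1 - \<delta>) * (1 - x) * ?c"
    using ratio_coeff_rec[of "Suc k"] by (simp add: eval_nat_numeral)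
  have 1: "?c \<le> 1 - x" using Suc by linarith
  have "0 \<le> x * real (Suc k) * ?e + (1 - \<delta>) * (1 - x) * ?c"
    using Suc x \<delta> ratio_coeff_nonneg by (intro add_nonneg_nonneg mult_nonneg_nonneg) auto
  then have 2: "0 \<le> ?c - ratio_coeff \<delta> x (Suc (Suc (Suc k)))"
    unfolding rec[symmetric] by (simp add: zero_le_mult_iff)
  have "real (Suc k) * ?e \<le> real (Suc k) * ((1 - x) / real (Suc (Suc k)))"
    using Suc by (intro mult_left_mono) auto
  also have "\<dots> \<le> 1 - x" using x by (simp add: field_simps)
  finally have "x * (real (Suc k) * ?e) \<le> x * (1 - x)" using x by (intro mult_left_mono) auto
  moreover have "(1 - \<delta>) * (1 - x) * ?c \<le> 1 * (1 - x) * (1 - x)"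
    using 1 ratio_coeff_nonneg \<delta> x by (intro mult_mono) auto
  ultimately have "real (k + 3) * (?c - ratio_coeff \<delta> x (Suc (Suc (Suc k)))) \<le> 1 - x"
    unfolding rec by (simp add: algebra_simps)
  then have "?c - ratio_coeff \<delta> x (Suc (Suc (Suc k))) \<le> (1 - x) / real (Suc (Suc (Suc k)))"
    by (simp add: field_simps)
  then show ?case using 1 2 by simp
qed

lemma ratio_coeff_antimono: "k \<le> m \<Longrightarrow> ratio_coeff \<delta> x m \<le> ratio_coeff \<delta> x k"
proof (rule lift_Suc_antimono_le[of "ratio_coeff \<delta> x"])
  fix k show "ratio_coeff \<delta> x (Suc k) \<le> ratio_coeff \<delta> x k"
  proof (cases k)
    case 0
    have "ratio_coeff \<delta> x (Suc 0) \<le> 1" using ratio_coeff_bounds[of 0] x by linarith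
    then show ?thesis using 0 ratio_coeff_0 by simp
  next
    case (Suc m) then show ?thesis using ratio_coeff_bounds[of m] by simp
  qed
qed

lemma ratio_coeff_diff_le:
  assumes "1 \<le> m"
  shows "ratio_coeff \<delta> x m - ratio_coeff \<delta> x (m + j) \<le> real j * (1 - x) / real m"
proof (induction j)
  case (Suc j)
  obtain l where l: "m + j = Suc l" using assms by (metis Suc_le_D add_Suc One_nat_def)
  have "ratio_coeff \<delta> x (m + j) - ratio_coeff \<delta> x (Suc (m + j)) \<le> (1 - x) / real (Suc (Suc l))"
    using ratio_coeff_bounds[of l] by (simp only: l)
  also have "\<dots> \<le> (1 - x) / real m" using x assms l by (intro divide_left_mono) auto
  finally have "ratio_coeff \<delta> x (m + j) - ratio_coeff \<delta> x (m + Suc j) \<le> (1 - x) / real m" by simp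
  moreover have "real (Suc j) * (1 - x) / real m = real j * (1 - x) / real m + (1 - x) / real m"
    by (simp add: distrib_right add_divide_distrib)
  ultimately show ?case using Suc.IH by linarith
qed simp

lemma sum_ratio_coeff_le: "(\<Sum>k<j. ratio_coeff \<delta> x k) \<le> 1 + real j * (1 - x)"
proof (induction j)
  case (Suc j)
  show ?case
  proof (cases j)
    case 0 then show ?thesis using x ratio_coeff_0 by simp
  next
    case (Suc m)
    then have "ratio_coeff \<delta> x j \<le> 1 - x" using ratio_coeff_bounds[of m] by simp
    then show ?thesis using Suc.IH by (simp add: algebra_simps)
  qed
qed simp

text \<open>The sequence decreases, so the sum of the differences telescopes up to the \<open>j\<close> initial terms.\<close>

lemma sum_ratio_coeff_shift_le:
  assumes "j \<le> N"
  shows "(\<Sum>k<N. \<bar>ratio_coeff \<delta> x k - (if j \<le> k then ratio_coeff \<delta> x (k - j) else 0)\<bar>) \<le> 2 * (1 + real j * (1 - x))"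
proof -
  have split: "(\<Sum>k<N. g k) = (\<Sum>k<j. g k) + (\<Sum>k<N - j. g (k + j))" for g :: "nat \<Rightarrow> real"
  proof -
    have "{..<N} = {..<j} \<union> {j..<N}" using assms by auto
    then have "sum g {..<N} = sum g {..<j} + sum g {j..<N}" by (simp add: sum.union_disjoint ivl_disj_int)
    also have "sum g {j..<N} = (\<Sum>k<N - j. g (k + j))"
      using sum.shift_bounds_nat_ivl[of g 0 j "N - j"] assms by (simp add: atLeast0LessThan)
    finally show ?thesis .
  qed
  have "(\<Sum>k<N. \<bar>ratio_coeff \<delta> x k - (if j \<le> k then ratio_coeff \<delta> x (k - j) else 0)\<bar>)
      = (\<Sum>k<j. ratio_coeff \<delta> x k) + (\<Sum>k<N - j. ratio_coeff \<delta> x k - ratio_coeff \<delta> x (k + j))"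
  proof -
    have "\<bar>ratio_coeff \<delta> x (k + j) - ratio_coeff \<delta> x k\<bar> = ratio_coeff \<delta> x k - ratio_coeff \<delta> x (k + j)" for k
      using ratio_coeff_antimono[of k "k + j"] by simp
    then show ?thesis unfolding split by (simp add: ratio_coeff_nonneg)
  qed
  also have "(\<Sum>k<N - j. ratio_coeff \<delta> x k - ratio_coeff \<delta> x (k + j)) = (\<Sum>k<N - j. ratio_coeff \<delta> x k) - (\<Sum>k<N. ratio_coeff \<delta> x k) + (\<Sum>k<j. ratio_coeff \<delta> x k)"
    using split[of "ratio_coeff \<delta> x"] by (simp add: sum_subtractf)
  also have "(\<Sum>k<N - j. ratio_coeff \<delta> x k) \<le> (\<Sum>k<N. ratio_coeff \<delta> x k)"
    by (intro sum_mono2 ratio_coeff_nonneg) auto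
  finally show ?thesis using sum_ratio_coeff_le[of j] by simp
qed

end

section \<open>Interpolation between the two means\<close>

lemma sum_convolution_le:
  fixes u v :: "nat \<Rightarrow> real"
  assumes "\<And>i. 0 \<le> u i" "\<And>i. 0 \<le> v i"
  shows "(\<Sum>k\<le>n. \<Sum>i\<le>k. u i * v (k - i)) \<le> (\<Sum>i\<le>n. u i) * (\<Sum>i\<le>n. v i)"
proof -
  have "(\<Sum>k\<le>n. \<Sum>i\<le>k. u i * v (k - i)) = (\<Sum>(i, j)\<in>{(i, j). i + j \<le> n}. u i * v j)"
    by (rule sum.triangle_reindex_eq[symmetric])
  also have "\<dots> \<le> (\<Sum>(i, j)\<in>{..n} \<times> {..n}. u i * v j)"
    by (intro sum_mono2) (auto simp: assms)
  also have "\<dots> = (\<Sum>i\<le>n. u i) * (\<Sum>i\<le>n. v i)"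
    by (simp add: sum_product sum.cartesian_product)
  finally show ?thesis .
qed

lemma mult_sum_le_sum_convolution:
  fixes u v :: "nat \<Rightarrow> real"
  assumes "\<And>i. 0 \<le> u i" "\<And>i. 0 \<le> v i"
  shows "(\<Sum>i\<le>m. u i) * (\<Sum>i\<le>n. v i) \<le> (\<Sum>k\<le>m + n. \<Sum>i\<le>k. u i * v (k - i))"
proof -
  have "finite {(i, j). i + j \<le> m + n}"
    by (rule finite_subset[of _ "{..m + n} \<times> {..m + n}"]) auto
  then have "(\<Sum>(i, j)\<in>{..m} \<times> {..n}. u i * v j) \<le> (\<Sum>(i, j)\<in>{(i, j). i + j \<le> m + n}. u i * v j)"
    by (intro sum_mono2) (auto simp: assms)
  also have "\<dots> = (\<Sum>k\<le>m + n. \<Sum>i\<le>k. u i * v (k - i))"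
    by (rule sum.triangle_reindex_eq)
  finally show ?thesis by (simp add: sum_product sum.cartesian_product)
qed

text \<open>This says that the integral of \<open>g\<close> over \<open>[0,1]\<close> is at most \<open>c\<close>. Majorants with an elementary primitive \<open>T\<close> are available
  throughout, and a bound on the derivative of a vector-valued function by that of \<open>T\<close> is what the mean value theorem needs.\<close>

definition integral_bound :: "(real \<Rightarrow> real) \<Rightarrow> real \<Rightarrow> bool" where
  "integral_bound g c \<longleftrightarrow> (\<exists>T T'. continuous_on {0..1} T \<and>
     (\<forall>x. 0 < x \<longrightarrow> x < 1 \<longrightarrow> (T has_real_derivative T' x) (at x) \<and> g x \<le> T' x) \<and> T 1 - T 0 \<le> c)"

lemma integral_bound_mono: "integral_bound g c \<Longrightarrow> c \<le> c' \<Longrightarrow> integral_bound g c'"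
  unfolding integral_bound_def by (meson order_trans)

definition interp_coeff :: "(nat \<Rightarrow> real) \<Rightarrow> (nat \<Rightarrow> complex) \<Rightarrow> real \<Rightarrow> nat \<Rightarrow> complex" where
  "interp_coeff d f x = exp_coeff (\<lambda>j. of_real (d j) * (1 + of_real (x ^ j) * (f j - 1)))"

lemma interp_coeff_0: "interp_coeff d f 0 m = of_real (exp_coeff d m)"
proof -
  have "interp_coeff d f 0 m = exp_coeff (\<lambda>j. of_real (d j)) m"
    unfolding interp_coeff_def by (intro exp_coeff_cong) simp
  then show ?thesis by (simp add: exp_coeff_of_real)
qed

lemma interp_coeff_1: "interp_coeff d f 1 m = exp_coeff (\<lambda>j. of_real (d j) * f j) m"
  by (simp add: interp_coeff_def)

lemma of_real_power_has_vector_derivative: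
  "((\<lambda>x. complex_of_real (x ^ k)) has_vector_derivative of_real (real k * x ^ (k - 1))) (at x)"
  by (rule has_vector_derivative_of_real)
     (auto intro!: derivative_eq_intros simp: has_real_derivative_iff_has_vector_derivative[symmetric])

text \<open>The generating function of the coefficients is \<open>p(z) H(x z)\<close>, where \<open>H\<close> has the exponents \<open>e\<^sub>j = d\<^sub>j (f\<^sub>j - 1)\<close>. Its derivative with
  respect to \<open>x\<close> is the product of itself with \<open>\<Sum>j\<ge>1. e\<^sub>j x^(j-1) z^j\<close>.\<close>

lemma interp_coeff_has_derivative:
  "((\<lambda>x. interp_coeff d f x m) has_vector_derivative
     (\<Sum>j=1..m. of_real (d j) * (f j - 1) * of_real (x ^ (j - 1)) * interp_coeff d f x (m - j))) (at x)"
proof -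
  define p where "p = exp_coeff (\<lambda>j. complex_of_real (d j))"
  define e where "e j = of_real (d j) * (f j - 1)" for j
  define h where "h = exp_coeff e"
  have G: "interp_coeff d f y i = (\<Sum>k\<le>i. h k * p (i - k) * of_real (y ^ k))" for y i
  proof -
    have "interp_coeff d f y i = exp_coeff (\<lambda>j. of_real y ^ j * e j + of_real (d j)) i"
      unfolding interp_coeff_def e_def by (intro exp_coeff_cong) (simp add: algebra_simps)
    also have "\<dots> = (\<Sum>k\<le>i. of_real y ^ k * h k * p (i - k))"
      by (simp only: exp_coeff_add exp_coeff_scale h_def p_def)
    finally show ?thesis by (simp add: mult_ac)
  qed
  have "((\<lambda>x. interp_coeff d f x m) has_vector_derivative
     (\<Sum>k\<le>m. h k * p (m - k) * of_real (real k * x ^ (k - 1)))) (at x)"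
    unfolding G
    by (intro has_vector_derivative_sum has_vector_derivative_mult_right
        of_real_power_has_vector_derivative)
  also have "(\<Sum>k\<le>m. h k * p (m - k) * of_real (real k * x ^ (k - 1)))
      = (\<Sum>j=1..m. e j * of_real (x ^ (j - 1)) * interp_coeff d f x (m - j))"
  proof (cases m)
    case (Suc l)
    define Q where "Q = Abs_fps (\<lambda>k. of_nat (Suc k) * h (Suc k) * of_real (x ^ k))"
    define H where "H = Abs_fps (\<lambda>k. h k * of_real (x ^ k))"
    define B where "B = Abs_fps (\<lambda>j. e (Suc j) * of_real (x ^ j))"
    have Q: "Q = H * B"
    proof (rule fps_ext)
      fix k
      have "fps_nth (H * B) k = (\<Sum>i=0..k. (e (Suc k - i) * h i) * of_real (x ^ k))"
        unfolding fps_mult_nth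
      proof (rule sum.cong)
        fix i assume "i \<in> {0..k}"
        then have "x ^ k = x ^ i * x ^ (k - i)" "Suc (k - i) = Suc k - i"
          by (auto simp flip: power_add)
        then show "fps_nth H i * fps_nth B (k - i) = (e (Suc k - i) * h i) * of_real (x ^ k)"
          by (simp add: H_def B_def)
      qed simp
      also have "\<dots> = of_nat (Suc k) * h (Suc k) * of_real (x ^ k)"
        unfolding h_def exp_coeff_rec
        by (simp add: sum_distrib_right atLeast0AtMost lessThan_Suc_atMost del: of_nat_Suc sum.lessThan_Suc)
      finally show "fps_nth Q k = fps_nth (H * B) k" by (simp add: Q_def)
    qed
    have HP: "fps_nth (H * Abs_fps p) i = interp_coeff d f x i" for i
      unfolding G fps_mult_nth atLeast0AtMost by (intro sum.cong refl) (simp add: H_def)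
    have "(\<Sum>k\<le>m. h k * p (m - k) * of_real (real k * x ^ (k - 1))) = fps_nth (Q * Abs_fps p) l"
      unfolding Suc sum.atMost_Suc_shift
      by (simp add: Q_def fps_mult_nth atLeast0AtMost del: of_nat_Suc) (simp add: mult_ac)
    also have "Q * Abs_fps p = B * (H * Abs_fps p)" by (simp add: Q mult_ac)
    also have "fps_nth \<dots> l = (\<Sum>j=0..l. fps_nth B j * interp_coeff d f x (l - j))"
      by (simp only: fps_mult_nth[of B] HP)
    also have "\<dots> = (\<Sum>j=1..m. e j * of_real (x ^ (j - 1)) * interp_coeff d f x (m - j))"
      unfolding One_nat_def sum.atLeast1_atMost_eq Suc lessThan_Suc_atMost atLeast0AtMost
      by (simp add: B_def)
    finally show ?thesis .
  qed simp
  finally show ?thesis by (simp only: e_def)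
qed

text \<open>The integrating factor \<open>exp (L 1 - L x)\<close> turns the derivative of the interpolating coefficient into a combination of
  differences, and its modulus is at most 1 since the real part of \<open>f j - 1\<close> is nonpositive.\<close>

lemma norm_exp_coeff_minus_exp_le:
  assumes d: "\<And>j. 1 \<le> j \<Longrightarrow> j \<le> n \<Longrightarrow> 0 \<le> d j"
    and f: "\<And>j. 1 \<le> j \<Longrightarrow> j \<le> n \<Longrightarrow> norm (f j) \<le> 1"
    and bound: "\<And>j. 1 \<le> j \<Longrightarrow> j \<le> n \<Longrightarrow> integral_bound
      (\<lambda>x. x ^ (j - 1) * norm (interp_coeff d f x (n - j) - interp_coeff d f x n)) (c j)"
  shows "norm (exp_coeff (\<lambda>j. of_real (d j) * f j) n
          - exp (\<Sum>j=1..n. of_real (d j) * ((f j - 1) / of_nat j)) * of_real (exp_coeff d n))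
      \<le> (\<Sum>j=1..n. d j * norm (f j - 1) * c j)"
proof -
  have "\<forall>j\<in>{1..n}. \<exists>T. continuous_on {0..1} (fst T) \<and> (\<forall>x. 0 < x \<longrightarrow> x < 1 \<longrightarrow>
      (fst T has_real_derivative snd T x) (at x) \<and>
      x ^ (j - 1) * norm (interp_coeff d f x (n - j) - interp_coeff d f x n) \<le> snd T x) \<and>
      fst T 1 - fst T 0 \<le> c j"
    using bound by (fastforce simp: integral_bound_def)
  from bchoice[OF this] obtain TT where TT: "\<forall>j\<in>{1..n}. continuous_on {0..1} (fst (TT j)) \<and>
      (\<forall>x. 0 < x \<longrightarrow> x < 1 \<longrightarrow> (fst (TT j) has_real_derivative snd (TT j) x) (at x) \<and>
      x ^ (j - 1) * norm (interp_coeff d f x (n - j) - interp_coeff d f x n) \<le> snd (TT j) x) \<and>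
      fst (TT j) 1 - fst (TT j) 0 \<le> c j" ..
  define T T' where "T j = fst (TT j)" and "T' j = snd (TT j)" for j
  have cont: "continuous_on {0..1} (T j)"
    and deriv: "\<And>x. 0 < x \<Longrightarrow> x < 1 \<Longrightarrow> (T j has_real_derivative T' j x) (at x)"
    and bound: "\<And>x. 0 < x \<Longrightarrow> x < 1 \<Longrightarrow>
      x ^ (j - 1) * norm (interp_coeff d f x (n - j) - interp_coeff d f x n) \<le> T' j x"
    and total: "T j 1 - T j 0 \<le> c j" if "1 \<le> j" "j \<le> n" for j
    using TT that by (auto simp: T_def T'_def)
  define L where "L x = (\<Sum>j=1..n. of_real (d j) * ((f j - 1) / of_nat j) * complex_of_real (x ^ j))" for x
  define L' where "L' x = (\<Sum>j=1..n. of_real (d j) * (f j - 1) * complex_of_real (x ^ (j - 1)))" for x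
  define G' where "G' x = (\<Sum>j=1..n. of_real (d j) * (f j - 1) * complex_of_real (x ^ (j - 1)) *
      interp_coeff d f x (n - j))" for x
  define \<phi> where "\<phi> x = exp (L 1 - L x) * interp_coeff d f x n" for x
  have L: "(L has_vector_derivative L' x) (at x)" for x
  proof -
    have "(L has_vector_derivative (\<Sum>j=1..n. of_real (d j) * ((f j - 1) / of_nat j) * of_real (real j * x ^ (j - 1)))) (at x)"
      unfolding L_def by (intro has_vector_derivative_sum has_vector_derivative_mult_right
        of_real_power_has_vector_derivative)
    also have "(\<Sum>j=1..n. of_real (d j) * ((f j - 1) / of_nat j) * of_real (real j * x ^ (j - 1))) = L' x"
      unfolding L'_def by (intro sum.cong) auto
    finally show ?thesis .
  qed
  have E: "((\<lambda>x. exp (L 1 - L x)) has_vector_derivative (- L' x * exp (L 1 - L x))) (at x)" for x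
  proof -
    have "((\<lambda>x. L 1 - L x) has_vector_derivative - L' x) (at x)"
      using L by (auto intro!: derivative_eq_intros)
    from field_vector_diff_chain_at[OF this DERIV_exp]
    show ?thesis by (simp add: o_def)
  qed
  have \<phi>: "(\<phi> has_vector_derivative exp (L 1 - L x) * (G' x - L' x * interp_coeff d f x n)) (at x)" for x
    unfolding \<phi>_def
    by (rule has_vector_derivative_eq_rhs[OF has_vector_derivative_mult[OF E interp_coeff_has_derivative]])
       (simp add: G'_def algebra_simps)
  have "norm (\<phi> 1 - \<phi> 0) \<le> (\<Sum>j=1..n. d j * norm (f j - 1) * T j 1) - (\<Sum>j=1..n. d j * norm (f j - 1) * T j 0)"
  proof (rule differentiable_bound_general[OF zero_less_one,
      where f = \<phi> and \<phi> = "\<lambda>x. \<Sum>j=1..n. d j * norm (f j - 1) * T j x"])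
    show "continuous_on {0..1} \<phi>"
      using \<phi> has_vector_derivative_continuous by (intro continuous_at_imp_continuous_on) blast
    show "continuous_on {0..1} (\<lambda>x. \<Sum>j=1..n. d j * norm (f j - 1) * T j x)"
      by (intro continuous_intros cont) auto
    fix x :: real assume x: "0 < x" "x < 1"
    show "(\<phi> has_vector_derivative exp (L 1 - L x) * (G' x - L' x * interp_coeff d f x n)) (at x)"
      by (rule \<phi>)
    show "((\<lambda>x. \<Sum>j=1..n. d j * norm (f j - 1) * T j x) has_vector_derivative
        (\<Sum>j=1..n. d j * norm (f j - 1) * T' j x)) (at x)"
      unfolding has_real_derivative_iff_has_vector_derivative[symmetric]
      using x by (intro DERIV_sum DERIV_cmult deriv) auto
    have "Re (L 1 - L x) \<le> 0"
    proof -
      have "Re (L 1 - L x) = (\<Sum>j=1..n. d j * (Re (f j) - 1) / real j * (1 - x ^ j))"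
        by (simp add: L_def sum_subtractf[symmetric] algebra_simps diff_divide_distrib flip: of_real_power)
      also have "\<dots> \<le> 0"
      proof (rule sum_nonpos)
        fix j assume j: "j \<in> {1..n}"
        have "d j * (Re (f j) - 1) \<le> 0"
          using d[of j] f[of j] j complex_Re_le_cmod[of "f j"] by (intro mult_nonneg_nonpos) auto
        then have "d j * (Re (f j) - 1) / real j \<le> 0" by (rule divide_nonpos_nonneg) simp
        then show "d j * (Re (f j) - 1) / real j * (1 - x ^ j) \<le> 0"
          using x by (intro mult_nonpos_nonneg) (auto simp: power_le_one)
      qed
      finally show ?thesis .
    qed
    then have E1: "norm (exp (L 1 - L x)) \<le> 1" by (simp add: norm_exp_eq_Re)
    have "norm (G' x - L' x * interp_coeff d f x n)
        = norm (\<Sum>j=1..n. of_real (d j) * (f j - 1) * complex_of_real (x ^ (j - 1)) *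
            (interp_coeff d f x (n - j) - interp_coeff d f x n))"
      by (simp add: G'_def L'_def sum_distrib_right sum_subtractf[symmetric] right_diff_distrib)
    also have "\<dots> \<le> (\<Sum>j=1..n. d j * norm (f j - 1) * T' j x)"
    proof (rule sum_norm_le)
      fix j assume j: "j \<in> {1..n}"
      have "norm (of_real (d j) * (f j - 1) * complex_of_real (x ^ (j - 1)) *
            (interp_coeff d f x (n - j) - interp_coeff d f x n))
          = d j * norm (f j - 1) * (x ^ (j - 1) * norm (interp_coeff d f x (n - j) - interp_coeff d f x n))"
        using d[of j] j x by (simp add: norm_mult norm_power)
      also have "\<dots> \<le> d j * norm (f j - 1) * T' j x"
        using d[of j] j x by (intro mult_left_mono bound) auto
      finally show "norm (of_real (d j) * (f j - 1) * complex_of_real (x ^ (j - 1)) *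
            (interp_coeff d f x (n - j) - interp_coeff d f x n)) \<le> d j * norm (f j - 1) * T' j x" .
    qed
    finally show "norm (exp (L 1 - L x) * (G' x - L' x * interp_coeff d f x n))
        \<le> (\<Sum>j=1..n. d j * norm (f j - 1) * T' j x)"
      using mult_mono[OF E1] by (fastforce simp: norm_mult)
  qed
  moreover have "\<phi> 1 = exp_coeff (\<lambda>j. of_real (d j) * f j) n"
    by (simp add: \<phi>_def interp_coeff_1)
  moreover have "L 0 = 0" by (auto simp: L_def intro!: sum.neutral)
  then have "\<phi> 0 = exp (\<Sum>j=1..n. of_real (d j) * ((f j - 1) / of_nat j)) * of_real (exp_coeff d n)"
    by (simp add: \<phi>_def interp_coeff_0 L_def)
  ultimately have "norm (exp_coeff (\<lambda>j. of_real (d j) * f j) n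
          - exp (\<Sum>j=1..n. of_real (d j) * ((f j - 1) / of_nat j)) * of_real (exp_coeff d n))
      \<le> (\<Sum>j=1..n. d j * norm (f j - 1) * (T j 1 - T j 0))"
    by (simp add: sum_subtractf[symmetric] right_diff_distrib)
  also have "\<dots> \<le> (\<Sum>j=1..n. d j * norm (f j - 1) * c j)"
    using d by (intro sum_mono mult_left_mono total) auto
  finally show ?thesis .
qed

section \<open>Regularity of the interpolating coefficients\<close>

lemma one_minus_power_le:
  fixes x :: real
  assumes "0 \<le> x" "x \<le> 1"
  shows "1 - x ^ j \<le> real j * (1 - x)"
  using Bernoulli_inequality[of "x - 1" j] assms by (simp add: algebra_simps)

context
  fixes d :: "nat \<Rightarrow> real" and f :: "nat \<Rightarrow> complex" and n :: nat and \<delta> D :: real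
  assumes n: "1 \<le> n"
    and \<delta>: "0 < \<delta>" "\<delta> \<le> 1"
    and d: "\<And>j. 1 \<le> j \<Longrightarrow> \<delta> \<le> d j \<and> d j \<le> D"
    and f: "\<And>j. 1 \<le> j \<Longrightarrow> j \<le> n \<Longrightarrow> norm (f j) \<le> 1"
begin

lemma weight_nonneg: "0 \<le> exp_coeff d m"
  using d \<delta> by (intro exp_coeff_nonneg) (auto intro: order_trans[of 0 \<delta>])

lemma weight_bound_pos: "0 < D"
  using d[of 1] \<delta> by simp

lemma sum_weights_le: "(\<Sum>i\<le>n. exp_coeff d i) \<le> (1 + 1 / \<delta>) * (real n * exp_coeff d n)"
  using d \<delta> n by (intro sum_exp_coeff_le_last) auto

text \<open>The factor \<open>1 + x^j (f j - 1)\<close> is a convex combination of \<open>1\<close> and \<open>f j\<close>.\<close>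

lemma norm_interp_coeff_le:
  assumes "0 \<le> x" "x \<le> 1" "m \<le> n"
  shows "norm (interp_coeff d f x m) \<le> exp_coeff d m"
  unfolding interp_coeff_def
proof (rule norm_exp_coeff_le)
  fix j assume j: "1 \<le> j" "j \<le> m"
  have x: "0 \<le> x ^ j" "x ^ j \<le> 1" using assms by (auto simp: power_le_one)
  have "norm (1 + of_real (x ^ j) * (f j - 1)) = norm (of_real (1 - x ^ j) + of_real (x ^ j) * f j)"
    by (simp add: algebra_simps)
  also have "\<dots> \<le> (1 - x ^ j) + x ^ j * norm (f j)"
  proof -
    have "norm (complex_of_real (1 - x ^ j)) = 1 - x ^ j" "norm (of_real (x ^ j) * f j) = x ^ j * norm (f j)"
      unfolding norm_mult norm_of_real using x by auto
    then show ?thesis using norm_triangle_ineq[of "complex_of_real (1 - x ^ j)" "of_real (x ^ j) * f j"] by simp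
  qed
  also have "\<dots> \<le> (1 - x ^ j) + x ^ j * 1"
    using x f[of j] j assms by (intro add_left_mono mult_left_mono) auto
  finally have "norm (1 + of_real (x ^ j) * (f j - 1)) \<le> 1" by simp
  then have "\<bar>d j\<bar> * norm (1 + of_real (x ^ j) * (f j - 1)) \<le> d j * 1"
    using d[of j] j \<delta> by (intro mult_mono) auto
  then show "norm (of_real (d j) * (1 + of_real (x ^ j) * (f j - 1))) \<le> d j" by (simp add: norm_mult)
qed

lemma norm_interp_coeff_diff_le_crude:
  assumes "0 \<le> x" "x \<le> 1" "2 * j \<le> n"
  shows "norm (interp_coeff d f x (n - j) - interp_coeff d f x n) \<le> (1 + 2 * D * (1 + 1 / \<delta>)) * exp_coeff d n"
proof -
  define \<kappa> where "\<kappa> = 1 + 1 / \<delta>"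
  have "real n * exp_coeff d (n - j) \<le> 2 * (real (n - j) * exp_coeff d (n - j))"
  proof -
    have "real n \<le> 2 * real (n - j)" using assms by linarith
    then show ?thesis using mult_right_mono[OF _ weight_nonneg[of "n - j"]] by (simp only: mult.assoc[symmetric])
  qed
  also have "real (n - j) * exp_coeff d (n - j) \<le> D * (\<Sum>i<n - j. exp_coeff d i)"
    using d \<delta> by (intro exp_coeff_le_sum) (auto intro: order_trans[of 0 \<delta>])
  also have "(\<Sum>i<n - j. exp_coeff d i) \<le> (\<Sum>i\<le>n. exp_coeff d i)"
    by (intro sum_mono2 weight_nonneg) auto
  also note sum_weights_le[folded \<kappa>_def]
  finally have "real n * exp_coeff d (n - j) \<le> real n * (2 * D * \<kappa> * exp_coeff d n)"
    using weight_bound_pos by (simp add: mult_ac)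
  then have "exp_coeff d (n - j) \<le> 2 * D * \<kappa> * exp_coeff d n" using n by simp
  moreover have "norm (interp_coeff d f x (n - j) - interp_coeff d f x n) \<le> exp_coeff d (n - j) + exp_coeff d n"
    using assms by (intro order_trans[OF norm_triangle_ineq4] add_mono norm_interp_coeff_le) auto
  ultimately show ?thesis unfolding \<kappa>_def[symmetric] by (simp add: algebra_simps)
qed

text \<open>The coefficients of \<open>d\<close> are the convolution of those of \<open>d - \<delta>\<close> with those of \<open>(1 - z)^(-\<delta>)\<close>. As the partial sums of the latter
  are at least \<open>n^\<delta>\<close>, those of the former are smaller than the partial sums of the weights by this factor, up to a constant that
  accounts for passing from \<open>2 n\<close> to \<open>n\<close>.\<close>

lemma sum_reduced_weights_le:
  "(\<Sum>i\<le>n. exp_coeff (\<lambda>j. d j - \<delta>) i) \<le> exp D * (1 + 1 / \<delta>) * (real n powr (1 - \<delta>) * exp_coeff d n)"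
proof -
  let ?w = "exp_coeff (\<lambda>j. d j - \<delta>)" and ?b = "exp_coeff (\<lambda>_::nat. \<delta>)"
  have nonneg: "0 \<le> ?w i" "0 \<le> ?b i" for i
    using d \<delta> by (auto intro!: exp_coeff_nonneg)
  have "(\<Sum>i\<le>n. ?w i) * real n powr \<delta> \<le> (\<Sum>i\<le>n. ?w i) * (\<Sum>i\<le>n. ?b i)"
  proof (intro mult_left_mono sum_nonneg nonneg)
    have "real n powr \<delta> \<le> (real n + 1) powr \<delta>" using \<delta> by (intro powr_mono2) auto
    also have "\<dots> \<le> (\<Sum>i\<le>n. ?b i)" using \<delta> by (intro sum_exp_coeff_const_ge) auto
    finally show "real n powr \<delta> \<le> (\<Sum>i\<le>n. ?b i)" .
  qed
  also have "\<dots> \<le> (\<Sum>k\<le>n + n. \<Sum>i\<le>k. ?w i * ?b (k - i))"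
    by (intro mult_sum_le_sum_convolution nonneg)
  also have "\<dots> = (\<Sum>k\<le>2 * n. exp_coeff d k)"
    using exp_coeff_add[of "\<lambda>j. d j - \<delta>" "\<lambda>_. \<delta>"] by (simp add: mult_2)
  also have "\<dots> \<le> exp D * (\<Sum>k\<le>n. exp_coeff d k)"
    using d \<delta> n by (intro sum_exp_coeff_double) (auto intro: order_trans[of 0 \<delta>])
  also have "\<dots> \<le> exp D * ((1 + 1 / \<delta>) * (real n * exp_coeff d n))"
    by (intro mult_left_mono sum_weights_le) auto
  finally show ?thesis using n \<delta> by (simp add: powr_diff field_simps)
qed

text \<open>The generating function here is the one of \<open>d - \<delta>\<close> times \<open>(1 - x z)^(-\<delta>)\<close>.\<close>

lemma sum_damped_weights_le:
  assumes "0 \<le> x" "x < 1"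
  shows "(\<Sum>i\<le>n. exp_coeff (\<lambda>j. d j - \<delta> + x ^ j * \<delta>) i)
    \<le> exp D * (1 + 1 / \<delta>) * (real n powr (1 - \<delta>) * exp_coeff d n) * (1 - x) powr (- \<delta>)"
proof -
  let ?w = "exp_coeff (\<lambda>j. d j - \<delta>)" and ?b = "exp_coeff (\<lambda>_::nat. \<delta>)"
  have nonneg: "0 \<le> ?w i" "0 \<le> x ^ i * ?b i" for i
    using d \<delta> assms by (auto intro!: exp_coeff_nonneg mult_nonneg_nonneg)
  have "(\<Sum>i\<le>n. exp_coeff (\<lambda>j. d j - \<delta> + x ^ j * \<delta>) i) = (\<Sum>k\<le>n. \<Sum>i\<le>k. ?w i * (x ^ (k - i) * ?b (k - i)))"
    by (simp only: exp_coeff_add exp_coeff_scale)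
  also have "\<dots> \<le> (\<Sum>i\<le>n. ?w i) * (\<Sum>i\<le>n. x ^ i * ?b i)"
    by (intro sum_convolution_le nonneg)
  also have "\<dots> \<le> exp D * (1 + 1 / \<delta>) * (real n powr (1 - \<delta>) * exp_coeff d n) * (1 - x) powr (- \<delta>)"
    using sum_exp_coeff_const_power_le[of \<delta> x n] \<delta> assms n weight_nonneg[of n]
    by (intro mult_mono sum_reduced_weights_le) (auto intro!: sum_nonneg nonneg simp: mult.commute)
  finally show ?thesis .
qed

text \<open>The interpolating coefficients are the convolution of the regular factor \<open>c\<close> with a sequence \<open>V\<close> dominated by \<open>v\<close>. In the
  difference of two of them, shifted by \<open>j\<close>, either the index of \<open>V\<close> is at least \<open>n / 4\<close>, where \<open>v\<close> is as small as its average up to a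
  constant, or the indices of both \<open>c\<close> are large, where \<open>c\<close> hardly changes.\<close>

lemma norm_interp_coeff_diff_le:
  assumes x: "0 \<le> x" "x < 1" and j: "1 \<le> j" "2 * j \<le> n"
  shows "norm (interp_coeff d f x (n - j) - interp_coeff d f x n)
    \<le> 4 * (2 * D + 1) * exp D * (1 + 1 / \<delta>) * (exp_coeff d n * real n powr (- \<delta>))
        * ((1 - x) powr (- \<delta>) * (1 + real j * (1 - x)))"
proof -
  define V where "V = exp_coeff (\<lambda>j. of_real ((d j - \<delta>) * (1 - x ^ j)) + of_real (d j * x ^ j) * f j)"
  define v where "v = exp_coeff (\<lambda>j. d j - \<delta> + x ^ j * \<delta>)"
  define c where "c = ratio_coeff \<delta> x"
  define S where "S = (\<Sum>i\<le>n. v i)"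
  define \<Delta> where "\<Delta> k = c k - (if j \<le> k then c (k - j) else 0)" for k
  define B where "B = 1 + real j * (1 - x)"
  have pw: "0 \<le> x ^ j" "x ^ j \<le> 1" for j using x by (auto simp: power_le_one)
  have G: "interp_coeff d f x m = (\<Sum>k\<le>m. of_real (c k) * V (m - k))" for m
  proof -
    have "interp_coeff d f x m = exp_coeff (\<lambda>j. of_real (\<delta> * (1 - x ^ j)) +
        (of_real ((d j - \<delta>) * (1 - x ^ j)) + of_real (d j * x ^ j) * f j)) m"
      unfolding interp_coeff_def by (intro exp_coeff_cong) (simp add: algebra_simps)
    then show ?thesis
      by (simp only: exp_coeff_add exp_coeff_of_real c_def ratio_coeff_def V_def)
  qed
  have "interp_coeff d f x (n - j) = (\<Sum>k\<le>n. of_real (if j \<le> k then c (k - j) else 0) * V (n - k))"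
  proof -
    have "(\<Sum>k\<le>n. of_real (if j \<le> k then c (k - j) else 0) * V (n - k))
        = (\<Sum>k\<in>{j..n}. of_real (c (k - j)) * V (n - k))"
      by (rule sum.mono_neutral_cong_right) auto
    also have "\<dots> = (\<Sum>k\<le>n - j. of_real (c k) * V (n - j - k))"
      using j by (intro sum.reindex_bij_witness[where i = "\<lambda>k. k + j" and j = "\<lambda>k. k - j"]) auto
    finally show ?thesis by (simp only: G)
  qed
  then have diff: "interp_coeff d f x (n - j) - interp_coeff d f x n = - (\<Sum>k\<le>n. of_real (\<Delta> k) * V (n - k))"
    by (simp add: G[of n] \<Delta>_def sum_subtractf left_diff_distrib)
  have V_le: "norm (V i) \<le> v i" if "i \<le> n" for i
    unfolding V_def v_def
  proof (rule norm_exp_coeff_le)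
    fix j assume j: "1 \<le> j" "j \<le> i"
    have dj: "\<delta> \<le> d j" "0 \<le> d j" using d[of j] \<delta> j by auto
    have "norm (of_real ((d j - \<delta>) * (1 - x ^ j)) + of_real (d j * x ^ j) * f j)
        \<le> norm (complex_of_real ((d j - \<delta>) * (1 - x ^ j))) + norm (of_real (d j * x ^ j) * f j)"
      by (rule norm_triangle_ineq)
    also have "norm (complex_of_real ((d j - \<delta>) * (1 - x ^ j))) = (d j - \<delta>) * (1 - x ^ j)"
      unfolding norm_of_real using dj pw[of j] by simp
    also have "norm (of_real (d j * x ^ j) * f j) \<le> d j * x ^ j * 1"
      unfolding norm_mult norm_of_real using dj pw[of j] f[of j] j that by (intro mult_mono) auto
    finally show "norm (of_real ((d j - \<delta>) * (1 - x ^ j)) + of_real (d j * x ^ j) * f j)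
        \<le> d j - \<delta> + x ^ j * \<delta>" by (simp add: algebra_simps)
  qed
  have v_exp: "0 \<le> d i - \<delta> + x ^ i * \<delta> \<and> d i - \<delta> + x ^ i * \<delta> \<le> D" if "1 \<le> i" for i
  proof
    show "0 \<le> d i - \<delta> + x ^ i * \<delta>" using d[OF that] pw[of i] \<delta> by (intro add_nonneg_nonneg) auto
    have "x ^ i * \<delta> \<le> 1 * \<delta>" using pw[of i] \<delta> by (intro mult_right_mono) auto
    then show "d i - \<delta> + x ^ i * \<delta> \<le> D" using d[OF that] by linarith
  qed
  have v_nonneg: "0 \<le> v i" for i
    unfolding v_def using v_exp by (intro exp_coeff_nonneg) auto
  have S_nonneg: "0 \<le> S" unfolding S_def by (intro sum_nonneg v_nonneg)
  \<comment> \<open>The cut at \<open>n / 4\<close> is chosen so that \<open>j \<le> n / 2\<close> still leaves \<open>k - j > n / 4\<close> whenever \<open>n - k < n / 4\<close>.\<close>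
  have v_le: "v i \<le> 4 * D / n * S" if "n \<le> 4 * i" "i \<le> n" for i
  proof -
    have "real n * v i \<le> 4 * (real i * v i)"
      using that mult_right_mono[OF _ v_nonneg, of "real n" "4 * real i" i] by (simp add: mult_ac)
    also have "real i * v i \<le> D * (\<Sum>k<i. v k)"
      unfolding v_def using v_exp by (intro exp_coeff_le_sum) auto
    also have "(\<Sum>k<i. v k) \<le> S"
      unfolding S_def using that by (intro sum_mono2 v_nonneg) auto
    finally show ?thesis using n weight_bound_pos by (simp add: field_simps)
  qed
  have c_le: "\<bar>\<Delta> k\<bar> \<le> 4 / n * B" if k: "4 * (n - k) < n" "k \<le> n" for k
  proof -
    have kj: "j < k" "n < 4 * (k - j)" using k j by linarith+
    have "\<bar>\<Delta> k\<bar> = c (k - j) - c k"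
      using kj ratio_coeff_antimono[of \<delta> x "k - j" k] \<delta> x by (simp add: \<Delta>_def c_def)
    also have "\<dots> \<le> real j * (1 - x) / real (k - j)"
      using ratio_coeff_diff_le[of \<delta> x "k - j" j] kj \<delta> x by (simp add: c_def)
    also have "\<dots> \<le> B / (n / 4)"
      using kj n x by (intro frac_le) (auto simp: B_def)
    finally show ?thesis by (simp add: field_simps)
  qed
  have "norm (interp_coeff d f x (n - j) - interp_coeff d f x n) \<le> (\<Sum>k\<le>n. \<bar>\<Delta> k\<bar> * v (n - k))"
    unfolding diff norm_minus_cancel
    by (intro sum_norm_le) (auto simp: norm_mult intro!: mult_left_mono V_le)
  also have "\<dots> \<le> (\<Sum>k\<le>n. \<bar>\<Delta> k\<bar> * (4 * D / n * S) + 4 / n * B * v (n - k))"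
  proof (intro sum_mono)
    fix k assume "k \<in> {..n}"
    then have k: "k \<le> n" by simp
    have nn: "0 \<le> \<bar>\<Delta> k\<bar> * (4 * D / n * S)" "0 \<le> 4 / n * B * v (n - k)"
      using S_nonneg weight_bound_pos v_nonneg[of "n - k"] x by (auto simp: B_def)
    show "\<bar>\<Delta> k\<bar> * v (n - k) \<le> \<bar>\<Delta> k\<bar> * (4 * D / n * S) + 4 / n * B * v (n - k)"
    proof (cases "4 * (n - k) < n")
      case True
      have "\<bar>\<Delta> k\<bar> * v (n - k) \<le> 4 / n * B * v (n - k)"
        by (intro mult_right_mono c_le v_nonneg True k)
      then show ?thesis using nn by linarith
    next
      case False
      have "\<bar>\<Delta> k\<bar> * v (n - k) \<le> \<bar>\<Delta> k\<bar> * (4 * D / n * S)"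
        using False by (intro mult_left_mono v_le) auto
      then show ?thesis using nn by linarith
    qed
  qed
  also have "\<dots> = (\<Sum>k\<le>n. \<bar>\<Delta> k\<bar>) * (4 * D / n * S) + 4 / n * B * S"
  proof -
    have "(\<Sum>k\<le>n. v (n - k)) = S"
      unfolding S_def by (rule sum.nat_diff_reindex[of v "Suc n", simplified lessThan_Suc_atMost diff_Suc_Suc])
    then show ?thesis by (simp only: sum.distrib flip: sum_distrib_left sum_distrib_right)
  qed
  also have "\<dots> \<le> (2 * B) * (4 * D / n * S) + 4 / n * B * S"
  proof -
    have "(\<Sum>k\<le>n. \<bar>\<Delta> k\<bar>) \<le> 2 * B"
      using sum_ratio_coeff_shift_le[of \<delta> x j "Suc n"] \<delta> x j
      by (simp add: \<Delta>_def c_def B_def lessThan_Suc_atMost del: sum.lessThan_Suc cong: if_cong)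
    then show ?thesis using S_nonneg weight_bound_pos by (intro add_right_mono mult_right_mono) auto
  qed
  also have "\<dots> = 4 * (2 * D + 1) * (B / n) * S"
    by (simp add: algebra_simps add_divide_distrib)
  also have "\<dots> \<le> 4 * (2 * D + 1) * (B / n) *
      (exp D * (1 + 1 / \<delta>) * (real n powr (1 - \<delta>) * exp_coeff d n) * (1 - x) powr (- \<delta>))"
    unfolding S_def v_def using x weight_bound_pos
    by (intro mult_left_mono sum_damped_weights_le) (auto simp: B_def)
  also have "real n powr (1 - \<delta>) = n * real n powr (- \<delta>)"
    using n by (simp add: powr_diff powr_minus field_simps)
  finally show ?thesis using n by (simp add: B_def mult_ac)
qed

section \<open>Integration over the interpolation parameter\<close>

lemma integral_bound_interp_diff_large:
  assumes j: "1 \<le> j" "j \<le> n" "n < 2 * j"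
  shows "integral_bound
      (\<lambda>x. x ^ (j - 1) * norm (interp_coeff d f x (n - j) - interp_coeff d f x n))
      (2 * (1 + 1 / \<delta>) * exp_coeff d n *
        (inverse (\<Sum>i\<le>n. exp_coeff d i) * exp_coeff d (n - j) + 1 / n))"
proof -
  define P where "P = (\<Sum>i\<le>n. exp_coeff d i)"
  define q where "q = exp_coeff d (n - j) + exp_coeff d n"
  have nonneg: "0 \<le> exp_coeff d i" for i by (rule weight_nonneg)
  define T where "T x = x ^ j / real j * q" for x
  have "P \<ge> exp_coeff d 0" unfolding P_def by (intro member_le_sum nonneg) auto
  then have P: "P > 0" by simp
  have P_le: "P \<le> (1 + 1 / \<delta>) * (real n * exp_coeff d n)"
    unfolding P_def by (rule sum_weights_le)
  have "1 / real n \<le> (1 + 1 / \<delta>) * exp_coeff d n * inverse P"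
    using P P_le n by (simp add: field_simps)
  then have "1 / real n * exp_coeff d (n - j) \<le> (1 + 1 / \<delta>) * exp_coeff d n * inverse P * exp_coeff d (n - j)"
    by (rule mult_right_mono) (rule nonneg)
  moreover have "1 / real n * exp_coeff d n \<le> (1 + 1 / \<delta>) * exp_coeff d n * (1 / n)"
    using mult_right_mono[of 1 "1 + 1 / \<delta>" "exp_coeff d n * (1 / n)"] \<delta> nonneg[of n] by (simp add: mult_ac)
  moreover have "T 1 - T 0 \<le> 2 * (1 / real n) * q"
  proof -
    have "1 / real j \<le> 2 * (1 / real n)" using j n by (simp add: field_simps)
    then have "1 / real j * q \<le> 2 * (1 / real n) * q"
      using nonneg[of n] nonneg[of "n - j"] by (intro mult_right_mono) (auto simp: q_def)
    then show ?thesis using j by (simp add: T_def power_0_left)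
  qed
  moreover have "2 * (1 / real n) * q = 2 * (1 / real n * exp_coeff d (n - j)) + 2 * (1 / real n * exp_coeff d n)"
    by (simp add: q_def distrib_left)
  moreover have "2 * (1 + 1 / \<delta>) * exp_coeff d n * (inverse P * exp_coeff d (n - j) + 1 / n)
      = 2 * ((1 + 1 / \<delta>) * exp_coeff d n * inverse P * exp_coeff d (n - j))
        + 2 * ((1 + 1 / \<delta>) * exp_coeff d n * (1 / n))"
    by (rule trans[OF distrib_left]) (simp only: mult.assoc)
  ultimately have "T 1 - T 0 \<le> 2 * (1 + 1 / \<delta>) * exp_coeff d n * (inverse P * exp_coeff d (n - j) + 1 / n)"
    by linarith
  moreover have "continuous_on {0..1} T" unfolding T_def by (intro continuous_intros) (use j in auto)
  moreover have "(T has_real_derivative x ^ (j - 1) * q) (at x)" for x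
    unfolding T_def using j by (auto intro!: derivative_eq_intros)
  moreover have "x ^ (j - 1) * norm (interp_coeff d f x (n - j) - interp_coeff d f x n) \<le> x ^ (j - 1) * q"
    if "0 < x" "x < 1" for x
  proof (rule mult_left_mono)
    show "norm (interp_coeff d f x (n - j) - interp_coeff d f x n) \<le> q"
      unfolding q_def using that
      by (intro order_trans[OF norm_triangle_ineq4] add_mono norm_interp_coeff_le) auto
  qed (use that in auto)
  ultimately show ?thesis unfolding P_def[symmetric] integral_bound_def
    by (intro exI[of _ T] exI[of _ "\<lambda>x. x ^ (j - 1) * q"]) auto
qed

text \<open>Since \<open>1 - x^j \<le> j (1 - x)\<close>, the function \<open>x^(j-1) (1 - x)^(-\<delta>)\<close> is dominated by a function with an elementary primitive: a
  multiple of \<open>(1 - x^j)^(-\<delta>)\<close> times the derivative of \<open>x^j\<close>. The other part of the bound, \<open>j x^(j-1) (1 - x)^(1-\<delta>)\<close>, is reduced to this one by an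
  integration by parts whose boundary terms vanish.\<close>

lemma integral_bound_interp_diff_small:
  assumes j: "1 \<le> j" "2 * j \<le> n" and \<delta>1: "\<delta> < 1"
  shows "integral_bound
      (\<lambda>x. x ^ (j - 1) * norm (interp_coeff d f x (n - j) - interp_coeff d f x n))
      (4 * (2 * D + 1) * exp D * (1 + 1 / \<delta>) * (2 / (1 - \<delta>)) * exp_coeff d n *
        (1 / n powr \<delta> * real j powr (\<delta> - 1)))"
proof -
  define K where "K = 4 * (2 * D + 1) * exp D * (1 + 1 / \<delta>) * (exp_coeff d n * real n powr (- \<delta>))"
  have K: "0 \<le> K"
    using weight_nonneg weight_bound_pos \<delta> by (simp add: K_def)
  define A where "A x = - (real j powr (\<delta> - 1) * (1 - x ^ j) powr (1 - \<delta>) / (1 - \<delta>))" for x :: real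
  define A' where "A' x = real j powr (\<delta> - 1) * ((1 - x ^ j) powr (- \<delta>) * (real j * x ^ (j - 1)))" for x :: real
  define B where "B x = x ^ j * (1 - x) powr (1 - \<delta>)" for x :: real
  define B' where "B' x = real j * x ^ (j - 1) * (1 - x) powr (1 - \<delta>) - x ^ j * ((1 - \<delta>) * (1 - x) powr (- \<delta>))"
    for x :: real
  define T where "T x = K * (2 * A x + B x)" for x
  define T' where "T' x = K * (2 * A' x + B' x)" for x
  have "continuous_on {0..1} (\<lambda>x::real. (1 - x ^ j) powr (1 - \<delta>))"
    using \<delta>1 by (intro continuous_on_powr' continuous_intros) (auto simp: power_le_one)
  moreover have "continuous_on {0..1} (\<lambda>x::real. (1 - x) powr (1 - \<delta>))"
    using \<delta>1 by (intro continuous_on_powr' continuous_intros) auto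
  ultimately have cont: "continuous_on {0..1} T"
    unfolding T_def A_def B_def
    by (intro continuous_on_mult continuous_on_add continuous_on_minus continuous_on_divide
        continuous_on_const continuous_on_power continuous_on_id) (use \<delta>1 in auto)
  \<comment> \<open>\<open>A\<close> comes from the substitution of \<open>x^j\<close>; \<open>B\<close> is the boundary term of the integration by parts, whose remaining integral is
    absorbed by the second copy of \<open>A\<close>.\<close>
  have deriv: "(T has_real_derivative T' x) (at x)" if x: "0 < x" "x < 1" for x
  proof -
    have xj: "x ^ j < 1" using x j by (simp add: power_less_one_iff)
    have "(A has_real_derivative A' x) (at x)"
      unfolding A_def A'_def using xj \<delta>1 by (auto intro!: derivative_eq_intros)
    moreover have "(B has_real_derivative B' x) (at x)"
      unfolding B_def B'_def using x by (auto intro!: derivative_eq_intros)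
    ultimately show ?thesis unfolding T_def T'_def by (auto intro!: derivative_eq_intros)
  qed
  have bound: "x ^ (j - 1) * norm (interp_coeff d f x (n - j) - interp_coeff d f x n) \<le> T' x"
    if x: "0 < x" "x < 1" for x
  proof -
    have xj: "x ^ j < 1" using x j by (simp add: power_less_one_iff)
    have A'_ge: "x ^ (j - 1) * (1 - x) powr (- \<delta>) \<le> A' x"
    proof -
      have "(real j * (1 - x)) powr (- \<delta>) \<le> (1 - x ^ j) powr (- \<delta>)"
        using one_minus_power_le[of x j] x xj \<delta> by (intro powr_mono2') auto
      then have "real j powr (- \<delta>) * (1 - x) powr (- \<delta>) \<le> (1 - x ^ j) powr (- \<delta>)"
        using x by (simp add: powr_mult)
      then have le: "real j powr (\<delta> - 1) * (real j powr (- \<delta>) * (1 - x) powr (- \<delta>) * (real j * x ^ (j - 1))) \<le> A' x"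
        unfolding A'_def using x by (intro mult_left_mono mult_right_mono) auto
      have "real j powr (\<delta> - 1) * real j powr (- \<delta>) * real j = 1"
        using j by (simp add: powr_diff powr_minus field_simps)
      then have "real j powr (\<delta> - 1) * (real j powr (- \<delta>) * (1 - x) powr (- \<delta>) * (real j * x ^ (j - 1)))
          = x ^ (j - 1) * (1 - x) powr (- \<delta>)"
        by (metis (no_types, opaque_lifting) mult.assoc mult.commute mult_1)
      with le show ?thesis by (simp only:)
    qed
    have B'_ge: "real j * x ^ (j - 1) * (1 - x) powr (1 - \<delta>) \<le> A' x + B' x"
    proof -
      have "x ^ j * ((1 - \<delta>) * (1 - x) powr (- \<delta>)) \<le> x ^ (j - 1) * (1 * (1 - x) powr (- \<delta>))"
        using x \<delta> by (intro mult_mono power_decreasing) auto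
      then show ?thesis using A'_ge unfolding B'_def by simp
    qed
    have "x ^ (j - 1) * norm (interp_coeff d f x (n - j) - interp_coeff d f x n)
        \<le> x ^ (j - 1) * (K * ((1 - x) powr (- \<delta>) * (1 + real j * (1 - x))))"
      unfolding K_def using x j norm_interp_coeff_diff_le[of x j]
      by (intro mult_left_mono) (auto simp: mult.assoc)
    also have "\<dots> = K * (x ^ (j - 1) * (1 - x) powr (- \<delta>) + real j * x ^ (j - 1) * (1 - x) powr (1 - \<delta>))"
    proof -
      have "(1 - x) powr (1 - \<delta>) = (1 - x) powr (- \<delta>) * (1 - x)"
        using x by (simp add: powr_diff powr_minus field_simps)
      then show ?thesis by (simp only:) (simp add: algebra_simps)
    qed
    also have "\<dots> \<le> T' x"
      unfolding T'_def using A'_ge B'_ge by (intro mult_left_mono K) auto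
    finally show ?thesis .
  qed
  have "T 1 - T 0 = K * (2 / (1 - \<delta>)) * real j powr (\<delta> - 1)"
    using j \<delta>1 by (simp add: T_def A_def B_def power_0_left)
  also have "\<dots> = 4 * (2 * D + 1) * exp D * (1 + 1 / \<delta>) * (2 / (1 - \<delta>)) * exp_coeff d n *
        (1 / n powr \<delta> * real j powr (\<delta> - 1))"
    by (simp add: K_def powr_minus_divide mult_ac)
  finally show ?thesis using cont deriv bound unfolding integral_bound_def by (intro exI[of _ T] exI[of _ T']) auto
qed

text \<open>For \<open>\<delta> = 1\<close> the preceding majorant is not integrable at \<open>1\<close>. Within distance \<open>1 / n\<close> of \<open>1\<close> the crude bound takes over, which amounts
  to replacing \<open>1 / (1 - x)\<close> by \<open>1 / (1 - x + 1 / n)\<close>; this is where the logarithm comes from.\<close>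

lemma integral_bound_interp_diff_small_eq_1:
  assumes j: "1 \<le> j" "2 * j \<le> n" and \<delta>1: "\<delta> = 1"
  shows "integral_bound
      (\<lambda>x. x ^ (j - 1) * norm (interp_coeff d f x (n - j) - interp_coeff d f x n))
      (4 * (8 * (2 * D + 1) * exp D + (1 + 4 * D)) * exp_coeff d n *
        (1 / n * (1 + ln (real n / real j))))"
proof -
  define K where "K = (8 * (2 * D + 1) * exp D + (1 + 4 * D)) * exp_coeff d n"
  have p: "0 \<le> exp_coeff d n" by (rule weight_nonneg)
  have D: "0 < D" by (rule weight_bound_pos)
  have K: "0 \<le> K" using p D by (simp add: K_def)
  define t where "t = real j / real n"
  have t: "0 < t" using j n by (simp add: t_def)
  define T where "T x = 2 * K / n * (x ^ j - ln (1 - x ^ j + t))" for x :: real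
  define T' where "T' x = 2 * K / n * (real j * x ^ (j - 1) + real j * x ^ (j - 1) / (1 - x ^ j + t))" for x :: real
  have pos: "0 < 1 - x ^ j + t" if "0 \<le> x" "x \<le> 1" for x :: real
    using power_le_one[OF that, of j] t by linarith
  have cont: "continuous_on {0..1} T"
    unfolding T_def by (intro continuous_intros) (use pos in force)
  have deriv: "(T has_real_derivative T' x) (at x)" if x: "0 < x" "x < 1" for x
    unfolding T_def T'_def using pos[of x] x n
    by (auto intro!: derivative_eq_intros simp: divide_simps)
  have bound: "x ^ (j - 1) * norm (interp_coeff d f x (n - j) - interp_coeff d f x n) \<le> T' x"
    if x: "0 < x" "x < 1" for x
  proof -
    let ?N = "norm (interp_coeff d f x (n - j) - interp_coeff d f x n)"
    define y where "y = 1 - x + 1 / n"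
    have y: "0 < y" using x n by (simp add: y_def add_pos_pos)
    have "?N \<le> 2 * K / n * (real j + 1 / y)"
    proof (cases "1 - x \<le> 1 / n")
      case True
      have "?N \<le> (1 + 4 * D) * exp_coeff d n"
        using norm_interp_coeff_diff_le_crude[of x j] x j \<delta>1 by simp
      also have "\<dots> \<le> K" using D p by (simp add: K_def distrib_right)
      also have "\<dots> \<le> 2 * K / n * (1 / y)"
      proof -
        have "n * y \<le> n * (2 / n)" using True n unfolding y_def by (intro mult_left_mono) auto
        then have "1 \<le> 2 / (n * y)" using y n by (simp add: le_divide_eq)
        then have "K * 1 \<le> K * (2 / (n * y))" using K by (intro mult_left_mono) auto
        then show ?thesis by (simp add: mult_ac)
      qed
      also have "\<dots> \<le> 2 * K / n * (real j + 1 / y)" using K by (intro mult_left_mono) auto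
      finally show ?thesis .
    next
      case False
      have "?N \<le> 4 * (2 * D + 1) * exp D * 2 * (exp_coeff d n * (1 / n)) * (1 / (1 - x) * (1 + real j * (1 - x)))"
        using norm_interp_coeff_diff_le[of x j] x j \<delta>1 n by (simp add: powr_minus_divide)
      also have "1 / (1 - x) * (1 + real j * (1 - x)) = 1 / (1 - x) + real j"
        using x by (simp add: field_simps)
      also have "4 * (2 * D + 1) * exp D * 2 * (exp_coeff d n * (1 / n)) * (1 / (1 - x) + real j)
          \<le> (K / n) * (2 * (real j + 1 / y))"
      proof (rule mult_mono)
        have "8 * (2 * D + 1) * exp D * exp_coeff d n \<le> K"
          using D p by (simp add: K_def distrib_right)
        then have "8 * (2 * D + 1) * exp D * exp_coeff d n / n \<le> K / n"
          by (rule divide_right_mono) simp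
        then show "4 * (2 * D + 1) * exp D * 2 * (exp_coeff d n * (1 / n)) \<le> K / n"
          by (simp add: mult_ac)
        have "2 / (2 * (1 - x)) \<le> 2 / y"
          using False x y by (intro divide_left_mono) (auto simp: y_def)
        moreover have "2 / (2 * (1 - x)) = 1 / (1 - x)" using x by (simp add: divide_simps)
        ultimately have "1 / (1 - x) \<le> 2 / y" by (simp only:)
        then show "1 / (1 - x) + real j \<le> 2 * (real j + 1 / y)" by simp
      qed (use K x in auto)
      finally show ?thesis by (simp add: mult_ac)
    qed
    then have "x ^ (j - 1) * ?N \<le> x ^ (j - 1) * (2 * K / n * (real j + 1 / y))"
      using x by (intro mult_left_mono) auto
    also have "\<dots> \<le> x ^ (j - 1) * (2 * K / n * (real j + real j / (1 - x ^ j + t)))"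
    proof -
      have "1 - x ^ j + t \<le> real j * y"
        using one_minus_power_le[of x j] x by (simp add: y_def t_def algebra_simps)
      then have "1 / y \<le> real j / (1 - x ^ j + t)"
        using y pos[of x] x by (simp add: field_simps)
      then show ?thesis using x K by (intro mult_left_mono add_left_mono) auto
    qed
    also have "\<dots> = T' x" by (simp add: T'_def algebra_simps)
    finally show ?thesis .
  qed
  have "T 1 = 2 * K / n * (1 - ln t)" "T 0 = 2 * K / n * (- ln (1 + t))"
    using j by (auto simp: T_def power_0_left)
  then have "T 1 - T 0 = 2 * K / n * ((1 - ln t) - (- ln (1 + t)))"
    by (simp only: right_diff_distrib)
  also have "(1 - ln t) - (- ln (1 + t)) = 1 + (ln (1 + t) - ln t)" by simp
  finally have "T 1 - T 0 = 2 * K / n * (1 + (ln (1 + t) - ln t))" .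
  also have "\<dots> \<le> 2 * K / n * (2 * (1 + ln (real n / real j)))"
  proof (rule mult_left_mono)
    define l where "l = ln (real n / real j)"
    have "ln t = - l" using j n by (simp add: t_def l_def ln_div)
    moreover have "ln (1 + t) \<le> t" using t by (intro ln_add_one_self_le_self) auto
    moreover have "t \<le> 1" using j n by (simp add: t_def)
    moreover have "0 \<le> l" using j n by (simp add: l_def)
    ultimately have "1 + (ln (1 + t) - ln t) \<le> 2 * (1 + l)" by argo
    then show "1 + (ln (1 + t) - ln t) \<le> 2 * (1 + ln (real n / real j))" by (simp only: l_def)
  qed (use K in auto)
  also have "\<dots> = 4 * (8 * (2 * D + 1) * exp D + (1 + 4 * D)) * exp_coeff d n *
        (1 / n * (1 + ln (real n / real j)))"
    using n by (simp add: K_def field_simps)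
  finally show ?thesis using cont deriv bound unfolding integral_bound_def by (intro exI[of _ T] exI[of _ T']) auto
qed

section \<open>The error estimate\<close>

text \<open>What is left for each of the two cases is the choice of \<open>E\<close>, the order of the contribution of an index \<open>j \<le> n / 2\<close>
  relative to the weight of index \<open>n\<close>.\<close>

lemma Delta_le:
  assumes C: "0 \<le> C" "2 * (1 + 1 / \<delta>) \<le> C" and E: "\<And>j. 1 \<le> j \<Longrightarrow> j \<le> n \<Longrightarrow> 1 / n \<le> E j"
    and small: "\<And>j. 1 \<le> j \<Longrightarrow> 2 * j \<le> n \<Longrightarrow> integral_bound
      (\<lambda>x. x ^ (j - 1) * norm (interp_coeff d f x (n - j) - interp_coeff d f x n))
      (C * exp_coeff d n * E j)"
  shows "Delta n d f \<le> D * C * (\<Sum>j=1..n. norm (f j - 1) *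
      (inverse (\<Sum>i\<le>n. exp_coeff d i) * exp_coeff d (n - j) + E j))"
proof -
  define P where "P = (\<Sum>i\<le>n. exp_coeff d i)"
  have nonneg: "0 \<le> exp_coeff d i" for i by (rule weight_nonneg)
  have p: "0 < exp_coeff d n"
  proof -
    have "exp_coeff d 0 \<le> P" unfolding P_def by (intro member_le_sum nonneg) auto
    also have "P \<le> (1 + 1 / \<delta>) * (real n * exp_coeff d n)"
      unfolding P_def by (rule sum_weights_le)
    finally show ?thesis using nonneg[of n] by (cases "exp_coeff d n = 0") auto
  qed
  have invP: "0 \<le> inverse P" unfolding P_def by (intro iffD2[OF inverse_nonnegative_iff_nonnegative] sum_nonneg nonneg)
  define R where "R j = inverse P * exp_coeff d (n - j) + E j" for j
  have bound: "integral_bound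
      (\<lambda>x. x ^ (j - 1) * norm (interp_coeff d f x (n - j) - interp_coeff d f x n))
      (C * exp_coeff d n * R j)" if j: "1 \<le> j" "j \<le> n" for j
  proof (cases "2 * j \<le> n")
    case True
    have "C * exp_coeff d n * E j \<le> C * exp_coeff d n * R j"
      unfolding R_def using C nonneg invP by (intro mult_left_mono) auto
    then show ?thesis by (rule integral_bound_mono[OF small[OF j(1) True]])
  next
    case False
    have "2 * (1 + 1 / \<delta>) * exp_coeff d n * (inverse P * exp_coeff d (n - j) + 1 / n)
        \<le> C * exp_coeff d n * R j"
      unfolding R_def using C nonneg invP E[OF j] by (intro mult_mono add_left_mono) auto
    moreover have "n < 2 * j" using False by simp
    ultimately show ?thesis
      using integral_bound_mono[OF integral_bound_interp_diff_large[OF j]] unfolding P_def by blast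
  qed
  let ?H = "exp (\<Sum>j=1..n. of_real (d j) * ((f j - 1) / of_nat j))"
  have d0: "0 \<le> d j" if "1 \<le> j" for j using d[OF that] \<delta> by linarith
  have "norm (exp_coeff (\<lambda>j. of_real (d j) * f j) n - ?H * of_real (exp_coeff d n))
      \<le> (\<Sum>j=1..n. d j * norm (f j - 1) * (C * exp_coeff d n * R j))"
    by (intro norm_exp_coeff_minus_exp_le bound) (use d0 f in auto)
  also have "\<dots> \<le> (\<Sum>j=1..n. D * norm (f j - 1) * (C * exp_coeff d n * R j))"
  proof (rule sum_mono)
    fix j assume j: "j \<in> {1..n}"
    have "0 \<le> 1 / real n" by simp
    also have "\<dots> \<le> E j" using j by (intro E) auto
    finally have "0 \<le> R j"
      unfolding R_def using invP nonneg by (intro add_nonneg_nonneg mult_nonneg_nonneg) auto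
    then show "d j * norm (f j - 1) * (C * exp_coeff d n * R j) \<le> D * norm (f j - 1) * (C * exp_coeff d n * R j)"
      using d[of j] j C p by (intro mult_right_mono) auto
  qed
  also have "\<dots> = (D * C * (\<Sum>j=1..n. norm (f j - 1) * R j)) * exp_coeff d n"
    by (simp add: sum_distrib_left sum_distrib_right mult_ac)
  finally have "norm (exp_coeff (\<lambda>j. of_real (d j) * f j) n - ?H * of_real (exp_coeff d n)) / exp_coeff d n
      \<le> D * C * (\<Sum>j=1..n. norm (f j - 1) * R j)"
    using p by (simp add: field_simps)
  moreover have "Delta n d f = norm (exp_coeff (\<lambda>j. of_real (d j) * f j) n - ?H * of_real (exp_coeff d n)) / exp_coeff d n"
  proof -
    have "weighted_mean n (mult_fun n d) (mult_fun n f) - ?H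
        = (exp_coeff (\<lambda>j. of_real (d j) * f j) n - ?H * of_real (exp_coeff d n)) / of_real (exp_coeff d n)"
      using p by (simp add: weighted_mean_mult_fun field_simps)
    then show ?thesis using p by (simp add: Delta_def norm_divide)
  qed
  ultimately show ?thesis by (simp add: R_def P_def)
qed

end

theorem theorem3:
  fixes dm dp :: real
  assumes "0 < dm" and "0 < dp"
  shows "\<exists>c1>0. \<forall>(n::nat) (fhat :: nat \<Rightarrow> complex) (dhat :: nat \<Rightarrow> real).
      n \<ge> 1 \<longrightarrow>
      (\<forall>\<sigma>. \<sigma> permutes {1..n} \<longrightarrow> norm (mult_fun n fhat \<sigma>) \<le> 1) \<longrightarrow>
      (\<forall>j\<in>{1..n}. norm (fhat j) \<le> 1) \<longrightarrow>
      (\<forall>j\<ge>1. dm \<le> dhat j \<and> dhat j \<le> dp) \<longrightarrow>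
      (dm < 1 \<longrightarrow>
         Delta n dhat fhat \<le> c1 *
           (inverse (\<Sum>j=0..n. p_coeff dhat j) * (\<Sum>k=1..n. norm (fhat k - 1) * p_coeff dhat (n - k))
            + 1 / real n powr dm * (\<Sum>k=1..n. norm (fhat k - 1) * real k powr (dm - 1))
            + 1 / real n * (\<Sum>k=1..n. norm (fhat k - 1)))) \<and>
      (dm \<ge> 1 \<longrightarrow>
         Delta n dhat fhat \<le> c1 *
           (inverse (\<Sum>j=0..n. p_coeff dhat j) * (\<Sum>k=1..n. norm (fhat k - 1) * p_coeff dhat (n - k))
            + 1 / real n * (\<Sum>k=1..n. norm (fhat k - 1) * (1 + ln (real n / real k)))))"
proof -
  define C where "C = (if dm < 1
    then 2 * (1 + 1 / dm) + 4 * (2 * dp + 1) * exp dp * (1 + 1 / dm) * (2 / (1 - dm))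
    else 4 + 4 * (8 * (2 * dp + 1) * exp dp + (1 + 4 * dp)))"
  \<comment> \<open>The first summands serve the indices above \<open>n / 2\<close>, the others those below, with \<open>\<delta> = dm\<close> and \<open>\<delta> = 1\<close>, respectively.\<close>
  have C: "0 < C" using assms by (auto simp: C_def add_pos_pos)
  have lt1: "Delta n d f \<le> dp * C *
           (inverse (\<Sum>j=0..n. p_coeff d j) * (\<Sum>k=1..n. norm (f k - 1) * p_coeff d (n - k))
            + 1 / real n powr dm * (\<Sum>k=1..n. norm (f k - 1) * real k powr (dm - 1))
            + 1 / real n * (\<Sum>k=1..n. norm (f k - 1)))"
    if n: "1 \<le> n" and f: "\<forall>j\<in>{1..n}. norm (f j) \<le> 1" and d: "\<forall>j\<ge>1. dm \<le> d j \<and> d j \<le> dp"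
      and dm: "dm < 1"
    for n d and f :: "nat \<Rightarrow> complex"
  proof -
    define E where "E j = 1 / real n powr dm * real j powr (dm - 1) + 1 / real n" for j
    have "Delta n d f \<le> dp * C * (\<Sum>j=1..n. norm (f j - 1) *
        (inverse (\<Sum>i\<le>n. exp_coeff d i) * exp_coeff d (n - j) + E j))"
    proof (rule Delta_le[where \<delta> = dm])
      show "2 * (1 + 1 / dm) \<le> C" using assms dm by (simp add: C_def)
      show "1 / real n \<le> E j" for j by (simp add: E_def)
      fix j assume j: "1 \<le> j" "2 * j \<le> n"
      have p: "0 \<le> exp_coeff d n" using d assms by (intro exp_coeff_nonneg) (auto intro: order_trans[of 0 dm])
      have "4 * (2 * dp + 1) * exp dp * (1 + 1 / dm) * (2 / (1 - dm)) \<le> C"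
        using assms dm by (simp add: C_def)
      then have "4 * (2 * dp + 1) * exp dp * (1 + 1 / dm) * (2 / (1 - dm)) * exp_coeff d n *
          (1 / n powr dm * real j powr (dm - 1)) \<le> C * exp_coeff d n * E j"
        unfolding E_def using p C by (intro mult_mono) auto
      then show "integral_bound
        (\<lambda>x. x ^ (j - 1) * norm (interp_coeff d f x (n - j) - interp_coeff d f x n)) (C * exp_coeff d n * E j)"
        by (rule integral_bound_mono[rotated])
           (rule integral_bound_interp_diff_small, use n f d assms dm j in auto)
    qed (use n f d assms dm C in auto)
    also have "(\<Sum>j=1..n. norm (f j - 1) *
        (inverse (\<Sum>i\<le>n. exp_coeff d i) * exp_coeff d (n - j) + E j))
      = inverse (\<Sum>j=0..n. p_coeff d j) * (\<Sum>k=1..n. norm (f k - 1) * p_coeff d (n - k))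
            + 1 / real n powr dm * (\<Sum>k=1..n. norm (f k - 1) * real k powr (dm - 1))
            + 1 / real n * (\<Sum>k=1..n. norm (f k - 1))"
      unfolding E_def p_coeff_eq_exp_coeff atLeast0AtMost sum_distrib_left sum.distrib[symmetric]
      by (intro sum.cong refl) (simp add: algebra_simps)
    finally show ?thesis .
  qed
  have ge1: "Delta n d f \<le> dp * C *
           (inverse (\<Sum>j=0..n. p_coeff d j) * (\<Sum>k=1..n. norm (f k - 1) * p_coeff d (n - k))
            + 1 / real n * (\<Sum>k=1..n. norm (f k - 1) * (1 + ln (real n / real k))))"
    if n: "1 \<le> n" and f: "\<forall>j\<in>{1..n}. norm (f j) \<le> 1" and d: "\<forall>j\<ge>1. dm \<le> d j \<and> d j \<le> dp"
      and dm: "1 \<le> dm"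
    for n d and f :: "nat \<Rightarrow> complex"
  proof -
    define E where "E j = 1 / real n * (1 + ln (real n / real j))" for j
    have d1: "1 \<le> d j \<and> d j \<le> dp" if "1 \<le> j" for j using d dm that by (meson order_trans)
    have "Delta n d f \<le> dp * C * (\<Sum>j=1..n. norm (f j - 1) *
        (inverse (\<Sum>i\<le>n. exp_coeff d i) * exp_coeff d (n - j) + E j))"
    proof (rule Delta_le[where \<delta> = 1])
      have "0 \<le> 4 * (8 * (2 * dp + 1) * exp dp + (1 + 4 * dp))" using assms by simp
      then show "2 * (1 + 1 / 1) \<le> C" using dm by (simp add: C_def)
      show "1 / real n \<le> E j" if "1 \<le> j" "j \<le> n" for j
        using that mult_left_mono[of 1 "1 + ln (real n / real j)" "1 / real n"] by (simp add: E_def)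
      fix j assume j: "1 \<le> j" "2 * j \<le> n"
      have p: "0 \<le> exp_coeff d n" using d assms by (intro exp_coeff_nonneg) (auto intro: order_trans[of 0 dm])
      have "0 \<le> E j" using j by (simp add: E_def)
      then have "4 * (8 * (2 * dp + 1) * exp dp + (1 + 4 * dp)) * exp_coeff d n * E j \<le> C * exp_coeff d n * E j"
        using p dm by (intro mult_right_mono) (auto simp: C_def)
      then show "integral_bound
        (\<lambda>x. x ^ (j - 1) * norm (interp_coeff d f x (n - j) - interp_coeff d f x n)) (C * exp_coeff d n * E j)"
        unfolding E_def
        by (rule integral_bound_mono[rotated])
           (rule integral_bound_interp_diff_small_eq_1[where \<delta> = 1], use n f d1 j in auto)
    qed (use n f d1 C in auto)
    also have "(\<Sum>j=1..n. norm (f j - 1) *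
        (inverse (\<Sum>i\<le>n. exp_coeff d i) * exp_coeff d (n - j) + E j))
      = inverse (\<Sum>j=0..n. p_coeff d j) * (\<Sum>k=1..n. norm (f k - 1) * p_coeff d (n - k))
            + 1 / real n * (\<Sum>k=1..n. norm (f k - 1) * (1 + ln (real n / real k)))"
      unfolding E_def p_coeff_eq_exp_coeff atLeast0AtMost sum_distrib_left sum.distrib[symmetric]
      by (intro sum.cong refl) (simp add: algebra_simps)
    finally show ?thesis .
  qed
  have "0 < dp * C" using assms C by simp
  then show ?thesis using lt1 ge1 by (intro exI[of _ "dp * C"]) auto
qed

end
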